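(* The restricted wreath product $\mathbf{Z} \wr \mathbf{Z}$, equipped with the wreath metric $d_\wr$, is a coarsely coherent metric space.
   Context: $\mathbf{Z}\wr\mathbf{Z}$ is the semi-direct product $\big(\bigoplus_{h \in \mathbf{Z}} \mathbf{Z}\big) \rtimes \mathbf{Z}$, where the acting copy of $\mathbf{Z}$ permutes the summands by translation. The wreath metric $d_\wr$ is the word metric $d_\wr(x,y)=\|x^{-1}y\|$ associated to the generating set consisting of the generators $\pm 1$ of the copy of $\mathbf{Z}$ at index $0$ in $\bigoplus_{h\in\mathbf{Z}}\mathbf{Z}$ and the generators $\pm 1$ of the acting copy of $\mathbf{Z}$. Fix a commutative ring $R$. Let $X$ be a proper metric space. For $S \subset X$ and $b \ge 0$, $S[b]$ denotes the metric $b$-enlargement of $S$ (the points of $X$ at distance at most $b$ from $S$); $x[b]$ is the metric ball of radius $b$ centered at $x$. An $X$-filtered $R$-module is an $R$-module $F$ together with a covariant functor $S \mapsto F(S)$ from the set of subsets of $X$ to the family of $R$-submodules of $F$, both ordered by inclusion, such that $F(X)=F$ and $F(\emptyset)=0$. All filtered modules are assumed locally finitely generated: $F(S)$ is a finitely generated $R$-module for every bounded $S$. An $R$-linear homomorphism $f \colon F \to G$ of $X$-filtered modules is $b$-bicontrolled ($b \ge 0$) if for all subsets $S \subset X$: $x \in F(S)$ implies $f(x) \in G(S[b])$; and every $y$ in the image of $f$ that lies in $G(S)$ equals $f(x)$ for some $x \in F(S[b])$. It is bicontrolled if it is $b$-bicontrolled for some $b \ge 0$. $F$ is $D$-lean if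 for every $S \subset X$ every $u \in F(S)$ can be written $u=\sum_{x \in S} u_x$ with $u_x \in F(x[D])$ and only finitely many $u_x$ non-zero. $F$ is $D'$-scattered if every $u \in F$ can be written $u=\sum_{x\in X} u_x$ with $u_x \in F(x[D'])$ and only finitely many $u_x$ non-zero. $F$ is $d$-insular if $F(S) \cap F(T) \subset F(S[d]\cap T[d])$ for all $S,T \subset X$. $F$ is lean, scattered, or insular if it has the corresponding property for some constant $\ge 0$. $X$ is coarsely coherent if in any exact sequence $0 \to E' \xrightarrow{f} E \xrightarrow{g} E'' \to 0$ of $X$-filtered $R$-modules with $f$ and $g$ bicontrolled, $E$ lean and $E''$ insular, the module $E'$ is scattered. *)

theory Defs
  imports "HOL-Analysis.Analysis" "HOL-Algebra.Algebra"
begin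

definition linear_homs ::
    "('r, 'k) ring_scheme \<Rightarrow> ('r, 'a, 'p) module_scheme \<Rightarrow> ('r, 'b, 'q) module_scheme \<Rightarrow> ('a \<Rightarrow> 'b) set"
  where "linear_homs R M N = {f \<in> carrier M \<rightarrow> carrier N.
    (\<forall>x\<in>carrier M. \<forall>y\<in>carrier M. f (x \<oplus>\<^bsub>M\<^esub> y) = f x \<oplus>\<^bsub>N\<^esub> f y) \<and>
    (\<forall>r\<in>carrier R. \<forall>x\<in>carrier M. f (r \<odot>\<^bsub>M\<^esub> x) = r \<odot>\<^bsub>N\<^esub> f x)}"

definition short_exact ::
    "('r, 'k) ring_scheme \<Rightarrow> ('r, 'a, 'p) module_scheme \<Rightarrow> ('a \<Rightarrow> 'b) \<Rightarrow>
     ('r, 'b, 'q) module_scheme \<Rightarrow> ('b \<Rightarrow> 'c) \<Rightarrow> ('r, 'c, 's) module_scheme \<Rightarrow> bool"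
  where "short_exact R A f B g C \<longleftrightarrow>
    f \<in> linear_homs R A B \<and> g \<in> linear_homs R B C \<and>
    inj_on f (carrier A) \<and>
    f ` carrier A = {x \<in> carrier B. g x = \<zero>\<^bsub>C\<^esub>} \<and>
    g ` carrier B = carrier C"

definition finitely_generated_submodule ::
    "('r, 'k) ring_scheme \<Rightarrow> ('r, 'a, 'p) module_scheme \<Rightarrow> 'a set \<Rightarrow> bool"
  where "finitely_generated_submodule R M N \<longleftrightarrow> submodule N R M \<and>
    (\<exists>A. finite A \<and> A \<subseteq> N \<and> N = \<Inter>{H. submodule H R M \<and> A \<subseteq> H})"

text \<open>A filtered module is given by a module \<open>F\<close> and the function \<open>\<Phi>\<close> sending a subset \<open>S\<close> of the
  metric space to the submodule \<open>F(S)\<close>; only the values of \<open>\<Phi>\<close> on subsets of the carrier matter.\<close>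

context Metric_space
begin

text \<open>The points at distance at most \<open>b\<close> from \<open>S\<close>, where the distance to \<open>S\<close> is the infimum of the
  distances to its points, and is infinite if \<open>S\<close> is empty.\<close>

definition enlarge :: "'a set \<Rightarrow> real \<Rightarrow> 'a set"
  where "enlarge S b = {x \<in> M. S \<noteq> {} \<and> (INF y\<in>S. d x y) \<le> b}"

definition filtered_module ::
    "('r, 'k) ring_scheme \<Rightarrow> ('r, 'm, 'p) module_scheme \<Rightarrow> ('a set \<Rightarrow> 'm set) \<Rightarrow> bool"
  where "filtered_module R F \<Phi> \<longleftrightarrow>
    Module.module R F \<and>
    (\<forall>S\<subseteq>M. submodule (\<Phi> S) R F) \<and>
    (\<forall>S T. S \<subseteq> T \<and> T \<subseteq> M \<longrightarrow> \<Phi> S \<subseteq> \<Phi> T) \<and>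
    \<Phi> M = carrier F \<and> \<Phi> {} = {\<zero>\<^bsub>F\<^esub>} \<and>
    (\<forall>S\<subseteq>M. mbounded S \<longrightarrow> finitely_generated_submodule R F (\<Phi> S))"

definition bicontrolled ::
    "('r, 'm, 'p) module_scheme \<Rightarrow> ('a set \<Rightarrow> 'm set) \<Rightarrow> ('a set \<Rightarrow> 'n set) \<Rightarrow> ('m \<Rightarrow> 'n) \<Rightarrow> bool"
  where "bicontrolled F \<Phi> \<Gamma> f \<longleftrightarrow> (\<exists>b\<ge>0. \<forall>S\<subseteq>M.
    (\<forall>x\<in>\<Phi> S. f x \<in> \<Gamma> (enlarge S b)) \<and>
    (\<forall>y\<in>f ` carrier F \<inter> \<Gamma> S. \<exists>x\<in>\<Phi> (enlarge S b). y = f x))"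

definition lean :: "('r, 'm, 'p) module_scheme \<Rightarrow> ('a set \<Rightarrow> 'm set) \<Rightarrow> bool"
  where "lean F \<Phi> \<longleftrightarrow> (\<exists>D\<ge>0. \<forall>S\<subseteq>M. \<forall>u\<in>\<Phi> S. \<exists>v.
    (\<forall>x\<in>S. v x \<in> \<Phi> (mcball x D)) \<and>
    finite {x \<in> S. v x \<noteq> \<zero>\<^bsub>F\<^esub>} \<and>
    u = finsum F v {x \<in> S. v x \<noteq> \<zero>\<^bsub>F\<^esub>})"

definition scattered :: "('r, 'm, 'p) module_scheme \<Rightarrow> ('a set \<Rightarrow> 'm set) \<Rightarrow> bool"
  where "scattered F \<Phi> \<longleftrightarrow> (\<exists>D\<ge>0. \<forall>u\<in>carrier F. \<exists>v.
    (\<forall>x\<in>M. v x \<in> \<Phi> (mcball x D)) \<and>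
    finite {x \<in> M. v x \<noteq> \<zero>\<^bsub>F\<^esub>} \<and>
    u = finsum F v {x \<in> M. v x \<noteq> \<zero>\<^bsub>F\<^esub>})"

definition insular :: "('a set \<Rightarrow> 'm set) \<Rightarrow> bool"
  where "insular \<Phi> \<longleftrightarrow> (\<exists>b\<ge>0. \<forall>S\<subseteq>M. \<forall>T\<subseteq>M. \<Phi> S \<inter> \<Phi> T \<subseteq> \<Phi> (enlarge S b \<inter> enlarge T b))"

end

locale proper_metric_space = Metric_space +
  assumes compactin_mcball: "\<And>x r. x \<in> M \<Longrightarrow> compactin mtopology (mcball x r)"
begin

text \<open>HOL cannot quantify over types inside a formula, so the types containing the carriers of the
  three modules are parameters. A statement polymorphic in them covers all modules.\<close>

definition coarsely_coherent ::
    "('r, 'k) ring_scheme \<Rightarrow> 'e1 itself \<Rightarrow> 'e itself \<Rightarrow> 'e2 itself \<Rightarrow> bool"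
  where "coarsely_coherent R _ _ _ \<longleftrightarrow>
    (\<forall>(E' :: ('r, 'e1) module) \<Phi>' (E :: ('r, 'e) module) \<Phi> (E'' :: ('r, 'e2) module) \<Phi>'' f g.
      filtered_module R E' \<Phi>' \<and> filtered_module R E \<Phi> \<and> filtered_module R E'' \<Phi>'' \<and>
      short_exact R E' f E g E'' \<and>
      bicontrolled E' \<Phi>' \<Phi> f \<and> bicontrolled E \<Phi> \<Phi>'' g \<and>
      lean E \<Phi> \<and> insular \<Phi>'' \<longrightarrow>
      scattered E' \<Phi>')"

end

definition semidirect_product ::
    "('n, 'p) monoid_scheme \<Rightarrow> ('h, 'q) monoid_scheme \<Rightarrow> ('h \<Rightarrow> 'n \<Rightarrow> 'n) \<Rightarrow> ('n \<times> 'h) monoid"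
  where "semidirect_product N H \<phi> =
    \<lparr>carrier = carrier N \<times> carrier H,
     monoid.mult = (\<lambda>(n, h) (n', h'). (n \<otimes>\<^bsub>N\<^esub> \<phi> h n', h \<otimes>\<^bsub>H\<^esub> h')),
     one = (\<one>\<^bsub>N\<^esub>, \<one>\<^bsub>H\<^esub>)\<rparr>"

text \<open>Translation by \<open>t\<close> carries the summand with index \<open>h\<close> to the one with index \<open>h + t\<close>.\<close>

definition ZwrZ :: "((int \<Rightarrow> int) \<times> int) monoid"
  where "ZwrZ = semidirect_product (sum_group UNIV (\<lambda>_. integer_group)) integer_group
    (\<lambda>t f h. f (h - t))"

definition ZwrZ_gens :: "((int \<Rightarrow> int) \<times> int) set"
  where "ZwrZ_gens =
    {(\<lambda>h. if h = 0 then 1 else 0, 0), (\<lambda>h. if h = 0 then -1 else 0, 0), (\<lambda>_. 0, 1), (\<lambda>_. 0, -1)}"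

text \<open>Word length with respect to a generating set \<open>S\<close> that is closed under inverses.\<close>

definition word_norm :: "('g, 'k) monoid_scheme \<Rightarrow> 'g set \<Rightarrow> 'g \<Rightarrow> nat"
  where "word_norm G S x =
    (LEAST n. \<exists>w. set w \<subseteq> S \<and> length w = n \<and> foldr (\<lambda>a b. a \<otimes>\<^bsub>G\<^esub> b) w \<one>\<^bsub>G\<^esub> = x)"

text \<open>The locale \<^locale>\<open>Metric_space\<close> demands symmetry of the distance even outside the carrier, hence
  the value 0 there.\<close>

definition word_metric :: "('g, 'k) monoid_scheme \<Rightarrow> 'g set \<Rightarrow> 'g \<Rightarrow> 'g \<Rightarrow> real"
  where "word_metric G S x y =
    (if x \<in> carrier G \<and> y \<in> carrier G then real (word_norm G S (inv\<^bsub>G\<^esub> x \<otimes>\<^bsub>G\<^esub> y)) else 0)"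

definition wreath_metric :: "(int \<Rightarrow> int) \<times> int \<Rightarrow> (int \<Rightarrow> int) \<times> int \<Rightarrow> real"
  where "wreath_metric = word_metric ZwrZ ZwrZ_gens"

end

theory Submission
  imports Defs
begin

text \<open>
  Two independent facts give the theorem: a metric space of finite decomposition complexity is
  coarsely coherent, and \<open>\<int> \<wr> \<int>\<close> has finite decomposition complexity.

  For the first, put on the kernel of \<open>g : E \<rightarrow> E''\<close> the filtration induced from \<open>E\<close>. Split an element
  \<open>k\<close> of the kernel lying over \<open>A \<union> B\<close> as \<open>u + w\<close> with \<open>u\<close> near \<open>A\<close> and \<open>w\<close> near \<open>B\<close>, which leanness
  permits. Neither summand need be in the kernel, but \<open>g u = - g w\<close> is supported near \<open>A\<close> and near
  \<open>B\<close>, so by insularity near both at once, and it lifts to an element \<open>c\<close> of \<open>E\<close> supported near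
  both. Then \<open>k = (u - c) + (c + w)\<close> splits \<open>k\<close> inside the kernel (lemma \<open>kernel_Un\<close>). If \<open>A\<close>
  and \<open>B\<close> are far apart no correction is needed, since \<open>g u\<close> is then supported on the empty set;
  therefore a union of arbitrarily many pieces far from each other can be split in one step
  (\<open>kernel_separated_UN\<close>). Each step enlarges supports by a fixed amount. A space of finite
  decomposition complexity reaches uniformly bounded pieces after well-foundedly many steps, and at
  each step the separation may be demanded larger than the enlargement accumulated so far, so every
  element of the kernel is a sum of kernel elements with uniformly bounded support
  (\<open>kernel_nbhd_subset_local_sums\<close>). As \<open>f\<close> is bicontrolled and injective, this says that \<open>E'\<close>
  is scattered.

  For the second, regard an element of \<open>\<int> \<wr> \<int>\<close> as a row of integer lamps with a cursor. Moving by
  distance \<open>n\<close> displaces the cursor by at most \<open>n\<close>, alters each lamp by at most \<open>n\<close>, and leaves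
  the lamps at distance more than \<open>n\<close> from the cursor unchanged. Slicing by the cursor position
  reduces to sets whose cursor stays in an interval. Such a set falls into pieces at distance more
  than \<open>r\<close> from each other, according to the lamps outside an \<open>r\<close>-neighbourhood of that interval.
  Within a piece only finitely many lamps vary, their number being bounded in terms of \<open>r\<close> and the
  length of the interval, and slicing by each of them in turn leaves uniformly bounded sets.
\<close>

section \<open>Finite sums of elements of a set\<close>

text \<open>The additive submonoid generated by \<open>P\<close>. Peeling off one summand at a time turns every
  claim about decompositions into an induction, without bookkeeping of index sets.\<close>

inductive_set finite_sums :: "('a, 'b) ring_scheme \<Rightarrow> 'a set \<Rightarrow> 'a set" for G P where
  zero: "\<zero>\<^bsub>G\<^esub> \<in> finite_sums G P"
| add: "p \<in> P \<Longrightarrow> s \<in> finite_sums G P \<Longrightarrow> p \<oplus>\<^bsub>G\<^esub> s \<in> finite_sums G P"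

lemma (in abelian_group) finite_sums_subset:
  assumes "P \<subseteq> carrier G" "s \<in> finite_sums G P" shows "s \<in> carrier G"
  using assms(2) by induction (use assms(1) in auto)

lemma (in abelian_group) finite_sums_base:
  assumes "P \<subseteq> carrier G" "p \<in> P" shows "p \<in> finite_sums G P"
  using finite_sums.add[OF assms(2) finite_sums.zero[of G P]] assms by auto

lemma (in abelian_group) finite_sums_closed_add:
  assumes P: "P \<subseteq> carrier G" and s: "s \<in> finite_sums G P" and t: "t \<in> finite_sums G P"
  shows "s \<oplus> t \<in> finite_sums G P"
  using s
proof induction
  case zero
  then show ?case using t finite_sums_subset[OF P t] by simp
next
  case (add p s)
  have "(p \<oplus> s) \<oplus> t = p \<oplus> (s \<oplus> t)"
    using P add.hyps finite_sums_subset[OF P] t by (intro a_assoc) auto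
  then show ?case using finite_sums.add[OF add.hyps(1) add.IH] by simp
qed

lemma (in abelian_group) finite_sums_bind:
  assumes Q: "Q \<subseteq> carrier G" and PQ: "P \<subseteq> finite_sums G Q" and s: "s \<in> finite_sums G P"
  shows "s \<in> finite_sums G Q"
  using s by induction (use PQ finite_sums.zero finite_sums_closed_add[OF Q] in auto)

text \<open>Summands with the same index can be collected, because each \<open>P x\<close> is closed under addition. The
  conclusion has the form of the decompositions required of lean and scattered modules.\<close>

lemma (in abelian_group) finite_sums_indexed:
  assumes P: "\<And>x. x \<in> I \<Longrightarrow> P x \<subseteq> carrier G" "\<And>x. x \<in> I \<Longrightarrow> \<zero> \<in> P x"
    "\<And>x p q. x \<in> I \<Longrightarrow> p \<in> P x \<Longrightarrow> q \<in> P x \<Longrightarrow> p \<oplus> q \<in> P x"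
    and s: "s \<in> finite_sums G (\<Union>x\<in>I. P x)"
  shows "\<exists>v. (\<forall>x\<in>I. v x \<in> P x) \<and> finite {x \<in> I. v x \<noteq> \<zero>} \<and> s = finsum G v {x \<in> I. v x \<noteq> \<zero>}"
  using s
proof induction
  case zero
  show ?case using P(2) by (intro exI[of _ "\<lambda>_. \<zero>"]) simp
next
  case (add p s)
  then obtain v x0 where v: "\<forall>x\<in>I. v x \<in> P x" "finite {x \<in> I. v x \<noteq> \<zero>}"
    and s_eq: "s = finsum G v {x \<in> I. v x \<noteq> \<zero>}" and x0: "x0 \<in> I" "p \<in> P x0"
    by (elim exE conjE UN_E)
  define v' where "v' = v(x0 := p \<oplus> v x0)"
  define A where "A = insert x0 {x \<in> I. v x \<noteq> \<zero>}"
  have A: "finite A" "A \<subseteq> I" using v x0 by (auto simp: A_def)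
  have v': "\<forall>x\<in>I. v' x \<in> P x" using v x0 P(3) by (auto simp: v'_def)
  have "w \<in> A \<rightarrow> carrier G" if "\<forall>x\<in>I. w x \<in> P x" for w
    using that A(2) by (intro funcsetI subsetD[OF P(1)]) auto
  then have vc: "v \<in> A \<rightarrow> carrier G" "v' \<in> A \<rightarrow> carrier G" using v(1) v' by auto
  have sub: "{x \<in> I. v' x \<noteq> \<zero>} \<subseteq> A" by (auto simp: A_def v'_def)
  have ins: "finsum G u A = u x0 \<oplus> finsum G u (A - {x0})" if "u \<in> A \<rightarrow> carrier G" for u
  proof -
    have "A = insert x0 (A - {x0})" by (auto simp: A_def)
    then show ?thesis using finsum_insert[of "A - {x0}" x0 u] that A(1) by auto
  qed
  have "finsum G v' {x \<in> I. v' x \<noteq> \<zero>} = finsum G v' A"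
    using A sub vc by (intro add.finprod_mono_neutral_cong_left) auto
  also have "\<dots> = (p \<oplus> v x0) \<oplus> finsum G v' (A - {x0})"
    using ins[OF vc(2)] by (simp add: v'_def)
  also have "finsum G v' (A - {x0}) = finsum G v (A - {x0})"
    using vc by (intro finsum_cong') (auto simp: v'_def)
  also have "(p \<oplus> v x0) \<oplus> finsum G v (A - {x0}) = p \<oplus> finsum G v A"
  proof -
    have "finsum G v (A - {x0}) \<in> carrier G" using vc(1) by (intro finsum_closed) auto
    moreover have "v x0 \<in> carrier G" "p \<in> carrier G" using v(1) x0 subsetD[OF P(1)] by auto
    ultimately show ?thesis unfolding ins[OF vc(1)] by (simp add: a_assoc)
  qed
  also have "finsum G v A = s"
    unfolding s_eq using A vc by (intro add.finprod_mono_neutral_cong_left[symmetric]) (auto simp: A_def)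
  finally have "p \<oplus> s = finsum G v' {x \<in> I. v' x \<noteq> \<zero>}" by (rule sym)
  then show ?case
    using v' finite_subset[OF sub A(1)] by (intro exI[of _ v'] conjI)
qed

section \<open>Neighbourhoods and finite decomposition complexity\<close>

context Metric_space
begin

text \<open>Asking for a point of \<open>S\<close> within distance \<open>r\<close>, instead of bounding the infimum of the distances as
  \<^const>\<open>enlarge\<close> does, makes enlargements commute with arbitrary unions and compose. The two notions
  agree up to an increase of the radius.\<close>

definition nbhd :: "'a set \<Rightarrow> real \<Rightarrow> 'a set"
  where "nbhd S r = {x \<in> M. \<exists>y\<in>S. d y x \<le> r}"

lemma nbhd_subset: "nbhd S r \<subseteq> M"
  by (auto simp: nbhd_def)

lemma nbhd_mono: "S \<subseteq> T \<Longrightarrow> r \<le> s \<Longrightarrow> nbhd S r \<subseteq> nbhd T s"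
  unfolding nbhd_def by (auto intro: order_trans)

lemma nbhd_empty [simp]: "nbhd {} r = {}"
  by (simp add: nbhd_def)

lemma nbhd_Un: "nbhd (S \<union> T) r = nbhd S r \<union> nbhd T r"
  by (auto simp: nbhd_def)

lemma nbhd_Union: "nbhd (\<Union>\<A>) r = (\<Union>P\<in>\<A>. nbhd P r)"
  by (auto simp: nbhd_def)

lemma subset_nbhd: "S \<subseteq> M \<Longrightarrow> 0 \<le> r \<Longrightarrow> S \<subseteq> nbhd S r"
  by (auto simp: nbhd_def intro!: bexI[rotated])

lemma nbhd_nbhd: "S \<subseteq> M \<Longrightarrow> nbhd (nbhd S r) s \<subseteq> nbhd S (r + s)"
  by (clarsimp simp: nbhd_def) (meson add_mono dual_order.trans subset_eq triangle)

lemma mcball_subset_nbhd: "x \<in> S \<Longrightarrow> mcball x r \<subseteq> nbhd S r"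
  by (auto simp: nbhd_def)

text \<open>The infimum of the distances to \<open>S\<close> need not be attained, hence the increase of the radius.\<close>

lemma enlarge_subset_nbhd: "enlarge S b \<subseteq> nbhd S (b + 1)"
proof
  fix x assume "x \<in> enlarge S b"
  then have x: "x \<in> M" "S \<noteq> {}" "(INF y\<in>S. d x y) < b + 1"
    by (auto simp: enlarge_def)
  then obtain y where "y \<in> S" "d x y < b + 1"
    using cInf_lessD[of "d x ` S" "b + 1"] by auto
  then show "x \<in> nbhd S (b + 1)"
    using x(1) commute[of x y] by (auto simp: nbhd_def intro!: bexI[of _ y])
qed

definition separated :: "real \<Rightarrow> 'a set \<Rightarrow> 'a set \<Rightarrow> bool"
  where "separated r S T \<longleftrightarrow> (\<forall>x\<in>S. \<forall>y\<in>T. r < d x y)"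

lemma separated_nbhd:
  assumes "separated (r + 2 * s) S T" "S \<subseteq> M" "T \<subseteq> M"
  shows "separated r (nbhd S s) (nbhd T s)"
  unfolding separated_def
proof (intro ballI)
  fix x y assume "x \<in> nbhd S s" "y \<in> nbhd T s"
  then obtain p q where p: "p \<in> S" "d p x \<le> s" "x \<in> M" and q: "q \<in> T" "d q y \<le> s" "y \<in> M"
    by (auto simp: nbhd_def)
  have "p \<in> M" "q \<in> M" using p q assms by auto
  then have "d p q \<le> d p x + d x y + d q y"
    using triangle[of p x q] triangle'[of x y q] triangle[of x y q] commute[of q y] p(3) q(3) by linarith
  moreover have "r + 2 * s < d p q"
    using assms(1) p q by (auto simp: separated_def)
  ultimately show "r < d x y" using p q by linarith
qed

lemma separated_nbhd_disjoint:
  assumes "separated (2 * s) S T" "S \<subseteq> M" "T \<subseteq> M"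
  shows "nbhd S s \<inter> nbhd T s = {}"
proof -
  have "separated 0 (nbhd S s) (nbhd T s)"
    using separated_nbhd[of 0 s S T] assms by simp
  then show ?thesis
    using nbhd_subset by (fastforce simp: separated_def)
qed

text \<open>The \<open>r\<close>-decompositions of Guentner, Tessera and Yu: two colours of pieces, where pieces of the same
  colour are more than \<open>r\<close> apart.\<close>

definition decomposes :: "real \<Rightarrow> 'a set set \<Rightarrow> 'a set \<Rightarrow> bool"
  where "decomposes r \<G> S \<longleftrightarrow> (\<exists>\<A> \<B>. \<A> \<subseteq> \<G> \<and> \<B> \<subseteq> \<G> \<and> S = \<Union>\<A> \<union> \<Union>\<B> \<and>
    pairwise (separated r) \<A> \<and> pairwise (separated r) \<B>)"

text \<open>The property belongs to a family of sets so that all bounds are uniform over the family. In each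
  step \<open>r\<close> may depend on everything that happened in the steps before.\<close>

inductive finite_decomposition_complexity :: "'a set set \<Rightarrow> bool" where
  bounded: "(\<And>S x y. S \<in> \<F> \<Longrightarrow> x \<in> S \<Longrightarrow> y \<in> S \<Longrightarrow> x \<in> M \<and> d x y \<le> D)
    \<Longrightarrow> finite_decomposition_complexity \<F>"
| decompose: "(\<And>r. \<exists>\<G>. finite_decomposition_complexity \<G> \<and> (\<forall>S\<in>\<F>. decomposes r \<G> S))
    \<Longrightarrow> finite_decomposition_complexity \<F>"

lemma finite_decomposition_complexity_subset:
  assumes "finite_decomposition_complexity \<F>" "S \<in> \<F>" shows "S \<subseteq> M"
  using assms
proof (induction arbitrary: S)
  case (decompose \<F>)
  obtain \<G> where \<G>: "\<And>T. T \<in> \<G> \<Longrightarrow> T \<subseteq> M" "decomposes 0 \<G> S"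
    using decompose.IH[of 0] decompose.prems by auto
  then obtain \<A> \<B> where "\<A> \<subseteq> \<G>" "\<B> \<subseteq> \<G>" "S = \<Union>\<A> \<union> \<Union>\<B>"
    by (auto simp: decomposes_def)
  then show ?case using \<G>(1) by blast
qed blast

end

section \<open>Excision for the kernel of a bicontrolled map\<close>

text \<open>What is needed of \<open>g : E \<rightarrow> E''\<close>, with all constants replaced by a common bound \<open>\<kappa>\<close>. Excision
  only adds and subtracts elements, so modules are replaced by abelian groups and submodules by
  subgroups.\<close>

locale controlled_kernel = Metric_space M d + E: abelian_group E + Q: abelian_group Q
  for M :: "'a set" and d
    and E :: "('e, 'p) ring_scheme" and Q :: "('q, 's) ring_scheme" +
  fixes \<Phi> :: "'a set \<Rightarrow> 'e set" and \<Psi> :: "'a set \<Rightarrow> 'q set" and g :: "'e \<Rightarrow> 'q" and \<kappa> :: real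
  assumes \<kappa>: "0 \<le> \<kappa>"
    and \<Phi>_subgroup: "S \<subseteq> M \<Longrightarrow> subgroup (\<Phi> S) (add_monoid E)"
    and \<Phi>_mono: "S \<subseteq> T \<Longrightarrow> T \<subseteq> M \<Longrightarrow> \<Phi> S \<subseteq> \<Phi> T"
    and \<Phi>_empty: "\<Phi> {} = {\<zero>\<^bsub>E\<^esub>}"
    and \<Psi>_subgroup: "S \<subseteq> M \<Longrightarrow> subgroup (\<Psi> S) (add_monoid Q)"
    and \<Psi>_mono: "S \<subseteq> T \<Longrightarrow> T \<subseteq> M \<Longrightarrow> \<Psi> S \<subseteq> \<Psi> T"
    and \<Psi>_empty: "\<Psi> {} = {\<zero>\<^bsub>Q\<^esub>}"
    and g_closed: "u \<in> carrier E \<Longrightarrow> g u \<in> carrier Q"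
    and g_add: "u \<in> carrier E \<Longrightarrow> w \<in> carrier E \<Longrightarrow> g (u \<oplus>\<^bsub>E\<^esub> w) = g u \<oplus>\<^bsub>Q\<^esub> g w"
    and lean: "S \<subseteq> M \<Longrightarrow> u \<in> \<Phi> S \<Longrightarrow>
      \<exists>Y v. finite Y \<and> Y \<subseteq> S \<and> (\<forall>x\<in>Y. v x \<in> \<Phi> (mcball x \<kappa>)) \<and> u = finsum E v Y"
    and control: "S \<subseteq> M \<Longrightarrow> u \<in> \<Phi> S \<Longrightarrow> g u \<in> \<Psi> (nbhd S \<kappa>)"
    and lift: "S \<subseteq> M \<Longrightarrow> u \<in> carrier E \<Longrightarrow> g u \<in> \<Psi> S \<Longrightarrow> \<exists>w\<in>\<Phi> (nbhd S \<kappa>). g w = g u"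
    and insular: "S \<subseteq> M \<Longrightarrow> T \<subseteq> M \<Longrightarrow> y \<in> \<Psi> S \<Longrightarrow> y \<in> \<Psi> T \<Longrightarrow> y \<in> \<Psi> (nbhd S \<kappa> \<inter> nbhd T \<kappa>)"
begin

lemma \<Phi>_closed:
  assumes "S \<subseteq> M"
  shows "u \<in> \<Phi> S \<Longrightarrow> u \<in> carrier E"
    and "\<zero>\<^bsub>E\<^esub> \<in> \<Phi> S"
    and "u \<in> \<Phi> S \<Longrightarrow> w \<in> \<Phi> S \<Longrightarrow> u \<oplus>\<^bsub>E\<^esub> w \<in> \<Phi> S"
    and "u \<in> \<Phi> S \<Longrightarrow> \<ominus>\<^bsub>E\<^esub> u \<in> \<Phi> S"
  using \<Phi>_subgroup[OF assms] subgroup.subset[of "\<Phi> S" "add_monoid E"]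
    subgroup.one_closed[of "\<Phi> S" "add_monoid E"] subgroup.m_closed[of "\<Phi> S" "add_monoid E"]
    subgroup.m_inv_closed[of "\<Phi> S" "add_monoid E"]
  by (auto simp: a_inv_def)

lemma \<Psi>_closed:
  assumes "S \<subseteq> M"
  shows "y \<in> \<Psi> S \<Longrightarrow> y \<in> carrier Q"
    and "y \<in> \<Psi> S \<Longrightarrow> \<ominus>\<^bsub>Q\<^esub> y \<in> \<Psi> S"
  using \<Psi>_subgroup[OF assms] subgroup.subset[of "\<Psi> S" "add_monoid Q"]
    subgroup.m_inv_closed[of "\<Psi> S" "add_monoid Q"]
  by (auto simp: a_inv_def)

lemma g_zero: "g \<zero>\<^bsub>E\<^esub> = \<zero>\<^bsub>Q\<^esub>"
  using g_add[of "\<zero>\<^bsub>E\<^esub>" "\<zero>\<^bsub>E\<^esub>"] g_closed[of "\<zero>\<^bsub>E\<^esub>"]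
  by (metis E.l_zero E.zero_closed Q.add.l_cancel_one')

lemma g_neg: "u \<in> carrier E \<Longrightarrow> g (\<ominus>\<^bsub>E\<^esub> u) = \<ominus>\<^bsub>Q\<^esub> g u"
  by (metis E.a_inv_closed E.r_neg Q.add.inv_equality Q.add.m_comm g_add g_closed g_zero)

lemma leanE:
  assumes "S \<subseteq> M" "u \<in> \<Phi> S"
  obtains Y v where "finite Y" "Y \<subseteq> S" "\<forall>x\<in>Y. v x \<in> \<Phi> (mcball x \<kappa>)" "u = finsum E v Y"
  using lean[OF assms] by (elim exE conjE) (rule that)

definition filtered_kernel :: "'a set \<Rightarrow> 'e set"
  where "filtered_kernel S = {k \<in> \<Phi> S. g k = \<zero>\<^bsub>Q\<^esub>}"

lemma kernel_mono: "S \<subseteq> T \<Longrightarrow> T \<subseteq> M \<Longrightarrow> filtered_kernel S \<subseteq> filtered_kernel T"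
  unfolding filtered_kernel_def by (auto dest: \<Phi>_mono)

lemma kernel_subset_carrier: "S \<subseteq> M \<Longrightarrow> filtered_kernel S \<subseteq> carrier E"
  using \<Phi>_closed(1) by (auto simp: filtered_kernel_def)

lemma finsum_in_nbhd:
  assumes "finite Y" "Y \<subseteq> S" "S \<subseteq> M" "\<And>x. x \<in> Y \<Longrightarrow> v x \<in> \<Phi> (mcball x \<kappa>)"
  shows "finsum E v Y \<in> \<Phi> (nbhd S \<kappa>)"
  using assms
proof (induction Y)
  case empty
  then show ?case using \<Phi>_closed(2)[OF nbhd_subset] by simp
next
  case (insert x Y)
  have v: "v y \<in> \<Phi> (nbhd S \<kappa>)" if "y \<in> insert x Y" for y
  proof -
    have "y \<in> S" using that insert.prems(1) by blast
    then show ?thesis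
      using insert.prems(3)[OF that] subsetD[OF \<Phi>_mono[OF mcball_subset_nbhd nbhd_subset]] by auto
  qed
  then have "v \<in> insert x Y \<rightarrow> carrier E"
    using \<Phi>_closed(1)[OF nbhd_subset] by auto
  then have "finsum E v (insert x Y) = v x \<oplus>\<^bsub>E\<^esub> finsum E v Y"
    using insert.hyps by (intro E.finsum_insert) auto
  moreover have "finsum E v Y \<in> \<Phi> (nbhd S \<kappa>)"
    using insert.prems by (intro insert.IH) auto
  ultimately show ?case
    using v[of x] \<Phi>_closed(3)[OF nbhd_subset] by simp
qed

lemma finsum_split:
  assumes "finite Y" "Y \<subseteq> M" "\<And>x. x \<in> Y \<Longrightarrow> v x \<in> \<Phi> (mcball x \<kappa>)"
  shows "finsum E v Y = finsum E v (Y \<inter> A) \<oplus>\<^bsub>E\<^esub> finsum E v (Y - A)"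
proof -
  have "v \<in> Y \<rightarrow> carrier E"
    using assms(3) \<Phi>_closed(1)[OF mcball_subset_mspace] by auto
  then have "finsum E v ((Y \<inter> A) \<union> (Y - A)) = finsum E v (Y \<inter> A) \<oplus>\<^bsub>E\<^esub> finsum E v (Y - A)"
    using assms(1) by (intro E.finsum_Un_disjoint) auto
  then show ?thesis by (simp add: Int_Diff_Un)
qed

text \<open>Since \<open>g u = - g w\<close>, control places this element near \<open>A\<close> as well as near \<open>B\<close>, and insularity
  places it near the intersection. The radius \<open>3 * \<kappa>\<close> is the one \<open>\<kappa>\<close> of the hypotheses, one for
  the control of \<open>g\<close> and one for insularity.\<close>

lemma opposite_images:
  assumes "A \<subseteq> M" "B \<subseteq> M" and u: "u \<in> \<Phi> (nbhd A \<kappa>)" and w: "w \<in> \<Phi> (nbhd B \<kappa>)"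
    and 0: "g (u \<oplus>\<^bsub>E\<^esub> w) = \<zero>\<^bsub>Q\<^esub>"
  shows "g u \<in> \<Psi> (nbhd A (3 * \<kappa>) \<inter> nbhd B (3 * \<kappa>))"
proof -
  have c: "u \<in> carrier E" "w \<in> carrier E"
    using u w \<Phi>_closed(1)[OF nbhd_subset] by auto
  have eq: "g u = \<ominus>\<^bsub>Q\<^esub> g w"
    using 0 c g_closed g_add by (metis Q.minus_equality)
  have nn: "nbhd (nbhd S \<kappa>) \<kappa> \<subseteq> nbhd S (2 * \<kappa>)" "nbhd (nbhd S (2 * \<kappa>)) \<kappa> \<subseteq> nbhd S (3 * \<kappa>)"
    if "S \<subseteq> M" for S
    using nbhd_nbhd[OF that, of \<kappa> \<kappa>] nbhd_nbhd[OF that, of "2 * \<kappa>" \<kappa>] by auto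
  have "g u \<in> \<Psi> (nbhd A (2 * \<kappa>))"
    using control[OF nbhd_subset u] subsetD[OF \<Psi>_mono[OF nn(1)[OF assms(1)] nbhd_subset]] by simp
  moreover have "g u \<in> \<Psi> (nbhd B (2 * \<kappa>))"
    using control[OF nbhd_subset w] subsetD[OF \<Psi>_mono[OF nn(1)[OF assms(2)] nbhd_subset]]
    unfolding eq by (simp add: \<Psi>_closed(2)[OF nbhd_subset])
  ultimately have "g u \<in> \<Psi> (nbhd (nbhd A (2 * \<kappa>)) \<kappa> \<inter> nbhd (nbhd B (2 * \<kappa>)) \<kappa>)"
    by (intro insular nbhd_subset)
  moreover have "nbhd (nbhd A (2 * \<kappa>)) \<kappa> \<inter> nbhd (nbhd B (2 * \<kappa>)) \<kappa> \<subseteq> nbhd A (3 * \<kappa>) \<inter> nbhd B (3 * \<kappa>)"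
    using nn(2)[OF assms(1)] nn(2)[OF assms(2)] by (rule Int_mono)
  ultimately show ?thesis
    using subsetD[OF \<Psi>_mono[OF _ le_infI1[OF nbhd_subset]]] by simp
qed

text \<open>The summands \<open>u\<close> and \<open>w\<close> that leanness gives are moved into the kernel by exchanging an element
  \<open>c\<close> with \<open>g c = g u\<close> between them. By \<open>opposite_images\<close> it can be found near both sets; lifting
  adds one more \<open>\<kappa>\<close> to the radius \<open>3 * \<kappa>\<close>.\<close>

lemma kernel_Un:
  assumes "A \<subseteq> M" "B \<subseteq> M" "k \<in> filtered_kernel (A \<union> B)"
  obtains k1 k2 where "k1 \<in> filtered_kernel (nbhd A (4 * \<kappa>))" "k2 \<in> filtered_kernel (nbhd B (4 * \<kappa>))"
    "k = k1 \<oplus>\<^bsub>E\<^esub> k2"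
proof -
  have k: "k \<in> \<Phi> (A \<union> B)" "g k = \<zero>\<^bsub>Q\<^esub>"
    using assms(3) by (auto simp: filtered_kernel_def)
  from leanE[OF Un_least[OF assms(1,2)] k(1)] obtain Y v where Y: "finite Y" "Y \<subseteq> A \<union> B"
    "\<forall>x\<in>Y. v x \<in> \<Phi> (mcball x \<kappa>)" and kX: "k = finsum E v Y" .
  define u where "u = finsum E v (Y \<inter> A)"
  define w where "w = finsum E v (Y - A)"
  have kuw: "k = u \<oplus>\<^bsub>E\<^esub> w"
    unfolding kX u_def w_def using Y assms by (intro finsum_split) auto
  have u: "u \<in> \<Phi> (nbhd A \<kappa>)" and w: "w \<in> \<Phi> (nbhd B \<kappa>)"
    unfolding u_def w_def using Y assms by (auto intro!: finsum_in_nbhd)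
  define I where "I = nbhd A (3 * \<kappa>) \<inter> nbhd B (3 * \<kappa>)"
  have IM: "I \<subseteq> M" unfolding I_def using nbhd_subset by auto
  have "g u \<in> \<Psi> I"
    unfolding I_def using opposite_images u w k(2) kuw assms by auto
  then obtain c where c: "c \<in> \<Phi> (nbhd I \<kappa>)" "g c = g u"
    using lift[OF IM \<Phi>_closed(1)[OF nbhd_subset u]] by auto
  have n4: "nbhd I \<kappa> \<subseteq> nbhd S (4 * \<kappa>)" "nbhd S \<kappa> \<subseteq> nbhd S (4 * \<kappa>)" if "S \<in> {A, B}" for S
  proof -
    have "nbhd I \<kappa> \<subseteq> nbhd (nbhd S (3 * \<kappa>)) \<kappa>"
      using that by (intro nbhd_mono) (auto simp: I_def)
    also have "\<dots> \<subseteq> nbhd S (4 * \<kappa>)"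
      using nbhd_nbhd[of S "3 * \<kappa>" \<kappa>] that assms by auto
    finally show "nbhd I \<kappa> \<subseteq> nbhd S (4 * \<kappa>)" .
    show "nbhd S \<kappa> \<subseteq> nbhd S (4 * \<kappa>)" using \<kappa> by (intro nbhd_mono) auto
  qed
  note in4 = subsetD[OF \<Phi>_mono[OF n4(1) nbhd_subset]] subsetD[OF \<Phi>_mono[OF n4(2) nbhd_subset]]
  have cc: "u \<in> carrier E" "w \<in> carrier E" "c \<in> carrier E"
    using u w c \<Phi>_closed(1)[OF nbhd_subset] by auto
  have "u \<oplus>\<^bsub>E\<^esub> \<ominus>\<^bsub>E\<^esub> c \<in> filtered_kernel (nbhd A (4 * \<kappa>))"
    using in4[of A] u c \<Phi>_closed[OF nbhd_subset] cc g_closed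
    by (auto simp: filtered_kernel_def g_add g_neg Q.r_neg)
  moreover have "c \<oplus>\<^bsub>E\<^esub> w \<in> filtered_kernel (nbhd B (4 * \<kappa>))"
    using in4[of B] w c \<Phi>_closed[OF nbhd_subset] cc k(2) kuw
    by (auto simp: filtered_kernel_def g_add)
  moreover have "k = (u \<oplus>\<^bsub>E\<^esub> \<ominus>\<^bsub>E\<^esub> c) \<oplus>\<^bsub>E\<^esub> (c \<oplus>\<^bsub>E\<^esub> w)"
    using cc kuw by (metis E.a_assoc E.add.inv_closed E.add.m_closed E.l_neg E.l_zero)
  ultimately show ?thesis by (rule that)
qed

text \<open>At distance more than \<open>6 * \<kappa>\<close> the \<open>3 * \<kappa>\<close>-neighbourhoods in \<open>opposite_images\<close> are disjoint, so
  the part of the sum near a single \<open>T i\<close> is already in the kernel, and so is the rest. Splitting off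
  one \<open>T i\<close> after another costs no further enlargement, unlike iterating \<open>kernel_Un\<close>; this is why
  infinitely many pieces are harmless.\<close>

lemma kernel_separated_finsum:
  assumes T: "\<And>i. i \<in> I \<Longrightarrow> T i \<subseteq> M"
    and sep: "\<And>i j. i \<in> I \<Longrightarrow> j \<in> I \<Longrightarrow> i \<noteq> j \<Longrightarrow> separated (6 * \<kappa>) (T i) (T j)"
    and "finite Y" "Y \<subseteq> (\<Union>i\<in>I. T i)" "\<And>x. x \<in> Y \<Longrightarrow> v x \<in> \<Phi> (mcball x \<kappa>)"
    and "g (finsum E v Y) = \<zero>\<^bsub>Q\<^esub>"
  shows "finsum E v Y \<in> finite_sums E (\<Union>i\<in>I. filtered_kernel (nbhd (T i) \<kappa>))"
  using assms(3-)
proof (induction Y rule: finite_psubset_induct)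
  case (psubset Y)
  let ?P = "\<Union>i\<in>I. filtered_kernel (nbhd (T i) \<kappa>)"
  show ?case
  proof (cases "Y = {}")
    case True
    then show ?thesis using finite_sums.zero by simp
  next
    case False
    then obtain x i where x: "x \<in> Y" "i \<in> I" "x \<in> T i" using psubset.prems by blast
    define B where "B = (\<Union>j\<in>I - {i}. T j)"
    have B: "B \<subseteq> M" "T i \<subseteq> M" using T x by (auto simp: B_def)
    define u where "u = finsum E v (Y \<inter> T i)"
    define w where "w = finsum E v (Y - T i)"
    have XM: "Y \<subseteq> M" using psubset.prems(1) T by blast
    have uw: "finsum E v Y = u \<oplus>\<^bsub>E\<^esub> w"
      unfolding u_def w_def using psubset XM by (intro finsum_split) auto
    have u: "u \<in> \<Phi> (nbhd (T i) \<kappa>)"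
      unfolding u_def using psubset B by (intro finsum_in_nbhd) auto
    have w: "w \<in> \<Phi> (nbhd B \<kappa>)"
      unfolding w_def using psubset B by (intro finsum_in_nbhd) (auto simp: B_def)
    have "separated (2 * (3 * \<kappa>)) (T i) B"
      using sep x(2) by (auto simp: separated_def B_def)
    then have "nbhd (T i) (3 * \<kappa>) \<inter> nbhd B (3 * \<kappa>) = {}"
      using separated_nbhd_disjoint B by blast
    then have gu: "g u = \<zero>\<^bsub>Q\<^esub>"
      using opposite_images[OF B(2,1) u w] uw psubset.prems(3) \<Psi>_empty by auto
    have "u \<in> carrier E" "w \<in> carrier E"
      using u w \<Phi>_closed(1)[OF nbhd_subset] by auto
    then have "g w = \<zero>\<^bsub>Q\<^esub>"
      using psubset.prems(3) uw gu g_add g_closed by (metis Q.l_zero)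
    then have "w \<in> finite_sums E ?P"
      unfolding w_def using psubset.prems x by (intro psubset.IH) auto
    moreover have "u \<in> ?P" using u gu x by (auto simp: filtered_kernel_def)
    ultimately show ?thesis unfolding uw by (intro finite_sums.add)
  qed
qed

lemma kernel_separated_UN:
  assumes T: "\<And>i. i \<in> I \<Longrightarrow> T i \<subseteq> M"
    and sep: "\<And>i j. i \<in> I \<Longrightarrow> j \<in> I \<Longrightarrow> i \<noteq> j \<Longrightarrow> separated (6 * \<kappa>) (T i) (T j)"
    and k: "k \<in> filtered_kernel (\<Union>i\<in>I. T i)"
  shows "k \<in> finite_sums E (\<Union>i\<in>I. filtered_kernel (nbhd (T i) \<kappa>))"
proof -
  have k': "k \<in> \<Phi> (\<Union>i\<in>I. T i)" "g k = \<zero>\<^bsub>Q\<^esub>" using k by (auto simp: filtered_kernel_def)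
  have "(\<Union>i\<in>I. T i) \<subseteq> M" using T by blast
  from leanE[OF this k'(1)] obtain Y v where Y: "finite Y" "Y \<subseteq> (\<Union>i\<in>I. T i)"
    "\<forall>x\<in>Y. v x \<in> \<Phi> (mcball x \<kappa>)" "k = finsum E v Y" .
  show ?thesis
    unfolding Y(4) using T sep Y(1,2) bspec[OF Y(3)] k'(2)[unfolded Y(4)]
    by (rule kernel_separated_finsum)
qed

definition local_sums :: "real \<Rightarrow> 'e set"
  where "local_sums D = finite_sums E (\<Union>x\<in>M. filtered_kernel (mcball x D))"

lemma local_kernel_subset: "(\<Union>x\<in>M. filtered_kernel (mcball x D)) \<subseteq> carrier E"
  using kernel_subset_carrier[OF mcball_subset_mspace] by blast

text \<open>The enlargement \<open>C\<close> is universally quantified in the induction because the pieces of a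
  decomposition have to be treated after they were enlarged by the previous step. The bound \<open>D\<close> is
  chosen before \<open>S\<close>, which is the uniformity over the family.\<close>

lemma kernel_nbhd_subset_local_sums:
  assumes "finite_decomposition_complexity \<F>"
  shows "\<exists>D. \<forall>S\<in>\<F>. filtered_kernel (nbhd S C) \<subseteq> local_sums D"
  using assms
proof (induction arbitrary: C)
  case (bounded \<F> D)
  have "filtered_kernel (nbhd S C) \<subseteq> local_sums (D + C)" if S: "S \<in> \<F>" for S
  proof (cases "S = {}")
    case True
    then show ?thesis
      using \<Phi>_empty finite_sums.zero by (auto simp: local_sums_def filtered_kernel_def)
  next
    case False
    then obtain x where x: "x \<in> S" "x \<in> M" using bounded S by blast
    have "nbhd S C \<subseteq> mcball x (D + C)"
    proof
      fix z assume "z \<in> nbhd S C"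
      then obtain y where y: "y \<in> S" "d y z \<le> C" "z \<in> M" by (auto simp: nbhd_def)
      then have "y \<in> M" "d x y \<le> D" using bounded S x by blast+
      then show "z \<in> mcball x (D + C)" using y x triangle[of x y z] by auto
    qed
    then have "filtered_kernel (nbhd S C) \<subseteq> (\<Union>x\<in>M. filtered_kernel (mcball x (D + C)))"
      using kernel_mono[OF _ mcball_subset_mspace] x(2) by (intro order_trans[OF _ UN_upper[of x]])
    then show ?thesis
      unfolding local_sums_def
      by (intro subsetI E.finite_sums_base[OF local_kernel_subset]) (rule subsetD)
  qed
  then show ?case by (intro exI[of _ "D + C"] ballI)
next
  case (decompose \<F>)
  (* Cutting into the two colours costs 4 * \<kappa>, giving C'. The pieces of one colour are then enlarged
     by C' and must still be 6 * \<kappa> apart. *)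
  define C' where "C' = C + 4 * \<kappa>"
  obtain \<G> where fG: "finite_decomposition_complexity \<G>"
    and IH: "\<exists>D. \<forall>S\<in>\<G>. filtered_kernel (nbhd S (C' + \<kappa>)) \<subseteq> local_sums D"
    and dec: "\<forall>S\<in>\<F>. decomposes (6 * \<kappa> + 2 * C') \<G> S"
    using decompose[of "6 * \<kappa> + 2 * C'"] by (elim exE conjE) (rule that, auto)
  obtain D where D: "\<And>S. S \<in> \<G> \<Longrightarrow> filtered_kernel (nbhd S (C' + \<kappa>)) \<subseteq> local_sums D"
    using IH by blast
  have half: "k \<in> local_sums D"
    if \<A>: "\<A> \<subseteq> \<G>" and sep: "pairwise (separated (6 * \<kappa> + 2 * C')) \<A>"
      and k: "k \<in> filtered_kernel (nbhd (nbhd (\<Union>\<A>) C) (4 * \<kappa>))" for \<A> k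
  proof -
    have M: "P \<subseteq> M" if "P \<in> \<A>" for P
      using finite_decomposition_complexity_subset[OF fG] \<A> that by blast
    have "nbhd (nbhd (\<Union>\<A>) C) (4 * \<kappa>) \<subseteq> (\<Union>P\<in>\<A>. nbhd P C')"
      unfolding nbhd_Union[symmetric] C'_def using M by (intro nbhd_nbhd) blast
    then have "filtered_kernel (nbhd (nbhd (\<Union>\<A>) C) (4 * \<kappa>)) \<subseteq> filtered_kernel (\<Union>P\<in>\<A>. nbhd P C')"
      using nbhd_subset by (intro kernel_mono UN_least)
    then have k': "k \<in> filtered_kernel (\<Union>P\<in>\<A>. nbhd P C')" using k by (rule subsetD)
    have "separated (6 * \<kappa>) (nbhd P C') (nbhd P' C')" if "P \<in> \<A>" "P' \<in> \<A>" "P \<noteq> P'" for P P'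
      using that M sep by (intro separated_nbhd) (auto simp: pairwise_def)
    then have "k \<in> finite_sums E (\<Union>P\<in>\<A>. filtered_kernel (nbhd (nbhd P C') \<kappa>))"
      using k' by (intro kernel_separated_UN nbhd_subset)
    moreover have "filtered_kernel (nbhd (nbhd P C') \<kappa>) \<subseteq> local_sums D" if "P \<in> \<A>" for P
      using kernel_mono[OF nbhd_nbhd[OF M[OF that]] nbhd_subset] D[of P] that \<A> by fast
    then have "(\<Union>P\<in>\<A>. filtered_kernel (nbhd (nbhd P C') \<kappa>)) \<subseteq> local_sums D"
      by (rule UN_least)
    ultimately show ?thesis
      unfolding local_sums_def by (intro E.finite_sums_bind[OF local_kernel_subset])
  qed
  have "filtered_kernel (nbhd S C) \<subseteq> local_sums D" if S: "S \<in> \<F>" for S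
  proof
    fix k assume k: "k \<in> filtered_kernel (nbhd S C)"
    obtain \<A> \<B> where AB: "\<A> \<subseteq> \<G>" "\<B> \<subseteq> \<G>" "S = \<Union>\<A> \<union> \<Union>\<B>"
      "pairwise (separated (6 * \<kappa> + 2 * C')) \<A>" "pairwise (separated (6 * \<kappa> + 2 * C')) \<B>"
      using bspec[OF dec S] unfolding decomposes_def by (elim exE conjE) (rule that)
    have "k \<in> filtered_kernel (nbhd (\<Union>\<A>) C \<union> nbhd (\<Union>\<B>) C)"
      using k unfolding AB(3) nbhd_Un .
    then obtain k1 k2 where "k1 \<in> filtered_kernel (nbhd (nbhd (\<Union>\<A>) C) (4 * \<kappa>))"
      "k2 \<in> filtered_kernel (nbhd (nbhd (\<Union>\<B>) C) (4 * \<kappa>))" "k = k1 \<oplus>\<^bsub>E\<^esub> k2"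
      by (rule kernel_Un[OF nbhd_subset nbhd_subset])
    then show "k \<in> local_sums D"
      using half[OF AB(1,4)] half[OF AB(2,5)] E.finite_sums_closed_add[OF local_kernel_subset]
      unfolding local_sums_def by simp
  qed
  then show ?case by (intro exI[of _ D] ballI)
qed

end

section \<open>Finite decomposition complexity implies coarse coherence\<close>

context Metric_space
begin

lemma filtered_moduleD:
  assumes "filtered_module R F \<Phi>"
  shows "abelian_group F"
    and "S \<subseteq> M \<Longrightarrow> subgroup (\<Phi> S) (add_monoid F)"
    and "S \<subseteq> T \<Longrightarrow> T \<subseteq> M \<Longrightarrow> \<Phi> S \<subseteq> \<Phi> T"
    and "\<Phi> M = carrier F"
    and "\<Phi> {} = {\<zero>\<^bsub>F\<^esub>}"
  using assms unfolding filtered_module_def by (auto simp: module_def submodule_def)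

lemma nbhd_mcball: "nbhd (mcball x r) s \<subseteq> mcball x (r + s)"
proof
  fix z assume "z \<in> nbhd (mcball x r) s"
  then obtain y where "x \<in> M" "y \<in> M" "z \<in> M" "d x y \<le> r" "d y z \<le> s"
    by (auto simp: nbhd_def)
  then show "z \<in> mcball x (r + s)" using triangle[of x y z] by auto
qed

lemma controlled_kernel_exact_sequence:
  assumes fE: "filtered_module R E \<Phi>" and fQ: "filtered_module R Q \<Psi>"
    and g: "g \<in> linear_homs R E Q" and bi: "bicontrolled E \<Phi> \<Psi> g"
    and lean: "lean E \<Phi>" and insular: "insular \<Psi>"
  obtains \<kappa> where "controlled_kernel M d E Q \<Phi> \<Psi> g \<kappa>"
proof -
  obtain b where b: "0 \<le> b"
    "\<forall>S\<subseteq>M. (\<forall>x\<in>\<Phi> S. g x \<in> \<Psi> (enlarge S b)) \<and>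
      (\<forall>y\<in>g ` carrier E \<inter> \<Psi> S. \<exists>x\<in>\<Phi> (enlarge S b). y = g x)"
    using bi unfolding bicontrolled_def by (elim exE conjE)
  obtain D where D: "0 \<le> D" "\<forall>S\<subseteq>M. \<forall>u\<in>\<Phi> S. \<exists>v. (\<forall>x\<in>S. v x \<in> \<Phi> (mcball x D)) \<and>
      finite {x \<in> S. v x \<noteq> \<zero>\<^bsub>E\<^esub>} \<and> u = finsum E v {x \<in> S. v x \<noteq> \<zero>\<^bsub>E\<^esub>}"
    using lean unfolding lean_def by (elim exE conjE)
  obtain c where c: "0 \<le> c"
    "\<forall>S\<subseteq>M. \<forall>T\<subseteq>M. \<Psi> S \<inter> \<Psi> T \<subseteq> \<Psi> (enlarge S c \<inter> enlarge T c)"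
    using insular unfolding insular_def by (elim exE conjE)
  (* The summand 1 pays for the passage from enlarge to nbhd. *)
  define \<kappa> where "\<kappa> = b + c + D + 1"
  have le: "enlarge S b \<subseteq> nbhd S \<kappa>" "enlarge S c \<subseteq> nbhd S \<kappa>" for S
    using order_trans[OF enlarge_subset_nbhd nbhd_mono[OF order_refl]] b(1) c(1) D(1)
    by (simp_all add: \<kappa>_def)
  interpret E: abelian_group E by (rule filtered_moduleD[OF fE])
  interpret Q: abelian_group Q by (rule filtered_moduleD[OF fQ])
  have "controlled_kernel M d E Q \<Phi> \<Psi> g \<kappa>"
  proof (intro controlled_kernel.intro controlled_kernel_axioms.intro)
    show "0 \<le> \<kappa>" using b c D by (simp add: \<kappa>_def)
    show "\<exists>Y v. finite Y \<and> Y \<subseteq> S \<and> (\<forall>x\<in>Y. v x \<in> \<Phi> (mcball x \<kappa>)) \<and> u = finsum E v Y"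
      if Su: "S \<subseteq> M" "u \<in> \<Phi> S" for S u
    proof -
      obtain v where v: "\<forall>x\<in>S. v x \<in> \<Phi> (mcball x D)" "finite {x \<in> S. v x \<noteq> \<zero>\<^bsub>E\<^esub>}"
        "u = finsum E v {x \<in> S. v x \<noteq> \<zero>\<^bsub>E\<^esub>}"
        using D(2)[rule_format, OF Su] by (elim exE conjE)
      have "\<Phi> (mcball x D) \<subseteq> \<Phi> (mcball x \<kappa>)" for x
        using b c by (intro filtered_moduleD(3)[OF fE] mcball_subset_concentric mcball_subset_mspace)
          (simp add: \<kappa>_def)
      then show ?thesis
        using v by (intro exI[of _ "{x \<in> S. v x \<noteq> \<zero>\<^bsub>E\<^esub>}"] exI[of _ v]) auto
    qed
    show "g u \<in> \<Psi> (nbhd S \<kappa>)" if "S \<subseteq> M" "u \<in> \<Phi> S" for S u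
      using b(2) that subsetD[OF filtered_moduleD(3)[OF fQ le(1) nbhd_subset]] by simp
    show "\<exists>w\<in>\<Phi> (nbhd S \<kappa>). g w = g u" if Su: "S \<subseteq> M" "u \<in> carrier E" "g u \<in> \<Psi> S" for S u
    proof -
      obtain w where "w \<in> \<Phi> (enlarge S b)" "g u = g w" using b(2) Su by (meson IntI imageI)
      then show ?thesis
        using subsetD[OF filtered_moduleD(3)[OF fE le(1) nbhd_subset]] by (intro bexI[of _ w]) simp_all
    qed
    show "y \<in> \<Psi> (nbhd S \<kappa> \<inter> nbhd T \<kappa>)" if "S \<subseteq> M" "T \<subseteq> M" "y \<in> \<Psi> S" "y \<in> \<Psi> T" for S T y
    proof -
      have "y \<in> \<Psi> (enlarge S c \<inter> enlarge T c)" using c(2) that by blast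
      moreover have "\<Psi> (enlarge S c \<inter> enlarge T c) \<subseteq> \<Psi> (nbhd S \<kappa> \<inter> nbhd T \<kappa>)"
        using le(2) nbhd_subset by (intro filtered_moduleD(3)[OF fQ] Int_mono le_infI1)
      ultimately show ?thesis by blast
    qed
    show "g u \<in> carrier Q" if "u \<in> carrier E" for u
      using g that by (auto simp: linear_homs_def)
    show "g (u \<oplus>\<^bsub>E\<^esub> w) = g u \<oplus>\<^bsub>Q\<^esub> g w" if "u \<in> carrier E" "w \<in> carrier E" for u w
      using g that by (auto simp: linear_homs_def)
  qed (fact filtered_moduleD[OF fE] filtered_moduleD[OF fQ] Metric_space_axioms)+
  then show ?thesis by (rule that)
qed

end

text \<open>The image of \<open>f\<close> is the kernel of \<open>g\<close>, so \<open>f u\<close> is a sum of kernel elements with uniformly bounded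
  support. Bicontrol of \<open>f\<close> lifts each of them to an element of \<open>E'\<close> with uniformly bounded support,
  and injectivity shows that the sum of the lifts is \<open>u\<close>.\<close>

lemma (in proper_metric_space) finite_decomposition_complexity_imp_coarsely_coherent:
  fixes R :: "('r, 'k) ring_scheme"
  assumes fdc: "finite_decomposition_complexity {M}"
  shows "coarsely_coherent R TYPE('e1) TYPE('e) TYPE('e2)"
  unfolding coarsely_coherent_def
proof (intro allI impI, elim conjE)
  fix E' :: "('r, 'e1) module" and \<Phi>' and E :: "('r, 'e) module" and \<Phi>
    and E'' :: "('r, 'e2) module" and \<Phi>'' f g
  assume f': "filtered_module R E' \<Phi>'" and fE: "filtered_module R E \<Phi>"
    and f'': "filtered_module R E'' \<Phi>''" and ex: "short_exact R E' f E g E''"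
    and bf: "bicontrolled E' \<Phi>' \<Phi> f" and bg: "bicontrolled E \<Phi> \<Phi>'' g"
    and lean: "lean E \<Phi>" and insular: "insular \<Phi>''"
  have f: "f \<in> linear_homs R E' E" and g: "g \<in> linear_homs R E E''" and inj: "inj_on f (carrier E')"
    and im: "f ` carrier E' = {x \<in> carrier E. g x = \<zero>\<^bsub>E''\<^esub>}"
    using ex by (auto simp: short_exact_def)
  obtain \<kappa> where "controlled_kernel M d E E'' \<Phi> \<Phi>'' g \<kappa>"
    using controlled_kernel_exact_sequence[OF fE f'' g bg lean insular] .
  then interpret controlled_kernel M d E E'' \<Phi> \<Phi>'' g \<kappa> .
  interpret E': abelian_group E' by (rule filtered_moduleD[OF f'])
  obtain D where D: "filtered_kernel (nbhd M 0) \<subseteq> local_sums D"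
    using kernel_nbhd_subset_local_sums[OF fdc, of 0] by auto
  obtain b where b: "0 \<le> b"
    "\<forall>S\<subseteq>M. \<forall>y\<in>f ` carrier E' \<inter> \<Phi> S. \<exists>u\<in>\<Phi>' (enlarge S b). y = f u"
    using bf unfolding bicontrolled_def by metis
  (* The absolute value only ensures that the constant is non-negative. *)
  define D' where "D' = \<bar>D\<bar> + b + 1"
  have \<Phi>'_closed: "\<Phi>' (mcball x D') \<subseteq> carrier E'" "\<zero>\<^bsub>E'\<^esub> \<in> \<Phi>' (mcball x D')"
    "p \<in> \<Phi>' (mcball x D') \<Longrightarrow> q \<in> \<Phi>' (mcball x D') \<Longrightarrow> p \<oplus>\<^bsub>E'\<^esub> q \<in> \<Phi>' (mcball x D')" for x p q
    using subgroup.subset[OF filtered_moduleD(2)[OF f' mcball_subset_mspace]]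
      subgroup.one_closed[OF filtered_moduleD(2)[OF f' mcball_subset_mspace]]
      subgroup.m_closed[OF filtered_moduleD(2)[OF f' mcball_subset_mspace]] by auto
  let ?P = "\<Union>x\<in>M. \<Phi>' (mcball x D')"
  have P: "?P \<subseteq> carrier E'" using \<Phi>'_closed(1) by blast
  have local: "\<exists>e\<in>?P. f e = p" if p: "p \<in> (\<Union>x\<in>M. filtered_kernel (mcball x D))" for p
  proof -
    obtain x where x: "x \<in> M" "p \<in> \<Phi> (mcball x D)" "g p = \<zero>\<^bsub>E''\<^esub>"
      using p by (auto simp: filtered_kernel_def)
    then have "p \<in> f ` carrier E'"
      unfolding im using \<Phi>_closed(1)[OF mcball_subset_mspace] by blast
    then obtain e where e: "e \<in> \<Phi>' (enlarge (mcball x D) b)" "p = f e"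
      using b(2)[rule_format, OF mcball_subset_mspace IntI] x(2) by blast
    have "enlarge (mcball x D) b \<subseteq> mcball x D'"
      using enlarge_subset_nbhd[of "mcball x D" b] nbhd_mcball[of x D "b + 1"]
        mcball_subset_concentric[of "D + (b + 1)" D' x] by (fastforce simp: D'_def)
    then have "e \<in> \<Phi>' (mcball x D')"
      using e(1) filtered_moduleD(3)[OF f' _ mcball_subset_mspace] by blast
    then show ?thesis using x(1) e(2) by blast
  qed
  have sums: "\<exists>e\<in>finite_sums E' ?P. f e = s" if "s \<in> local_sums D" for s
    using that unfolding local_sums_def
  proof induction
    case zero
    have "f \<zero>\<^bsub>E'\<^esub> = \<zero>\<^bsub>E\<^esub>"
    proof -
      have "f \<zero>\<^bsub>E'\<^esub> \<oplus>\<^bsub>E\<^esub> f \<zero>\<^bsub>E'\<^esub> = f (\<zero>\<^bsub>E'\<^esub> \<oplus>\<^bsub>E'\<^esub> \<zero>\<^bsub>E'\<^esub>)" "f \<zero>\<^bsub>E'\<^esub> \<in> carrier E"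
        using f by (auto simp: linear_homs_def simp del: E'.l_zero E'.r_zero)
      then show ?thesis by simp
    qed
    then show ?case using finite_sums.zero by blast
  next
    case (add p s)
    obtain e e' where e: "e \<in> ?P" "f e = p" "e' \<in> finite_sums E' ?P" "f e' = s"
      using add.IH local[OF add.hyps(1)] by blast
    then have "e \<in> carrier E'" "e' \<in> carrier E'"
      using P E'.finite_sums_subset[OF P] by blast+
    then have "f (e \<oplus>\<^bsub>E'\<^esub> e') = p \<oplus>\<^bsub>E\<^esub> s" using f e by (auto simp: linear_homs_def)
    then show ?case using finite_sums.add[OF e(1,3)] by blast
  qed
  show "scattered E' \<Phi>'"
    unfolding scattered_def
  proof (rule exI[of _ D'], intro conjI ballI)
    show "0 \<le> D'" using b(1) by (simp add: D'_def)
    fix u assume u: "u \<in> carrier E'"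
    have "f u \<in> filtered_kernel (nbhd M 0)"
    proof -
      have "f u \<in> {x \<in> carrier E. g x = \<zero>\<^bsub>E''\<^esub>}" unfolding im[symmetric] using u by (rule imageI)
      then have "f u \<in> carrier E" "g (f u) = \<zero>\<^bsub>E''\<^esub>" by auto
      moreover have "carrier E \<subseteq> \<Phi> (nbhd M 0)"
        using filtered_moduleD(4)[OF fE] \<Phi>_mono[OF subset_nbhd nbhd_subset, of M 0] by simp
      ultimately show ?thesis by (auto simp: filtered_kernel_def)
    qed
    from sums[OF subsetD[OF D this]] obtain e where e: "e \<in> finite_sums E' ?P" "f e = f u" by auto
    then have "u \<in> finite_sums E' ?P"
      using inj_onD[OF inj e(2) E'.finite_sums_subset[OF P e(1)] u] by simp
    then show "\<exists>v. (\<forall>x\<in>M. v x \<in> \<Phi>' (mcball x D')) \<and> finite {x \<in> M. v x \<noteq> \<zero>\<^bsub>E'\<^esub>} \<and>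
        u = finsum E' v {x \<in> M. v x \<noteq> \<zero>\<^bsub>E'\<^esub>}"
      using E'.finite_sums_indexed[of M "\<lambda>x. \<Phi>' (mcball x D')"] \<Phi>'_closed by simp
  qed
qed

section \<open>Slicing by integer-valued Lipschitz functions\<close>

lemma int_div_bounds:
  fixes u L :: int
  assumes "0 < L"
  shows "u div L * L \<le> u" "u < u div L * L + L"
  using div_mult_mod_eq[of u L] pos_mod_sign[OF assms, of u] pos_mod_bound[OF assms, of u] by linarith+

text \<open>Choose \<open>L \<ge> r\<close> and colour the slices by the parity of their number \<open>\<phi> x div L\<close>. Between two
  different slices of the same colour lies an entire slice, so the values of the 1-Lipschitz function
  \<open>\<phi>\<close> on them, and therefore their points, are more than \<open>L\<close> apart. The function may depend on
  the set being sliced.\<close>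

lemma (in Metric_space) finite_decomposition_complexity_slices:
  assumes "\<And>L :: int. 0 < L \<Longrightarrow> \<exists>\<G>. finite_decomposition_complexity \<G> \<and>
    (\<forall>S\<in>\<F>. \<exists>\<phi> :: 'a \<Rightarrow> int. (\<forall>x\<in>S. \<forall>y\<in>S. real_of_int \<bar>\<phi> x - \<phi> y\<bar> \<le> d x y) \<and> (\<forall>j. {x \<in> S. \<phi> x div L = j} \<in> \<G>))"
  shows "finite_decomposition_complexity \<F>"
proof (rule finite_decomposition_complexity.decompose)
  fix r :: real
  define L where "L = max 1 \<lceil>r\<rceil>"
  have "0 < L" "\<lceil>r\<rceil> \<le> L" by (auto simp: L_def)
  then have L: "0 < L" "r \<le> real_of_int L" by (auto simp: ceiling_le_iff)
  obtain \<G> where G: "finite_decomposition_complexity \<G>" and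
    cut: "\<forall>S\<in>\<F>. \<exists>\<phi> :: 'a \<Rightarrow> int. (\<forall>x\<in>S. \<forall>y\<in>S. real_of_int \<bar>\<phi> x - \<phi> y\<bar> \<le> d x y) \<and>
      (\<forall>j. {x \<in> S. \<phi> x div L = j} \<in> \<G>)"
    using assms[OF L(1)] by (elim exE conjE)
  have gap: "L < v - u" if "u div L + 2 \<le> v div L" for u v :: int
  proof -
    have "u < u div L * L + L" "v div L * L \<le> v" using int_div_bounds[OF L(1)] by auto
    moreover have "(u div L + 2) * L \<le> v div L * L" using that L(1) by (intro mult_right_mono) auto
    ultimately show ?thesis by (simp add: algebra_simps)
  qed
  have "decomposes r \<G> S" if S: "S \<in> \<F>" for S
  proof -
    obtain \<phi> :: "'a \<Rightarrow> int" where lip: "\<forall>x\<in>S. \<forall>y\<in>S. real_of_int \<bar>\<phi> x - \<phi> y\<bar> \<le> d x y"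
      and cell: "\<forall>j. {x \<in> S. \<phi> x div L = j} \<in> \<G>"
      using bspec[OF cut S] by (elim exE conjE)
    define slice where "slice j = {x \<in> S. \<phi> x div L = j}" for j
    have sep: "separated r (slice i) (slice j)" if "i + 2 \<le> j \<or> j + 2 \<le> i" for i j
      unfolding separated_def
    proof (intro ballI)
      fix x y assume "x \<in> slice i" "y \<in> slice j"
      then have xy: "x \<in> S" "y \<in> S" "\<phi> x div L = i" "\<phi> y div L = j" by (auto simp: slice_def)
      then have "L < \<bar>\<phi> x - \<phi> y\<bar>" using that gap[of "\<phi> x" "\<phi> y"] gap[of "\<phi> y" "\<phi> x"] by auto
      then show "r < d x y" using bspec[OF bspec[OF lip xy(1)] xy(2)] L(2) by linarith
    qed
    have "range (\<lambda>j. slice (2 * j)) \<subseteq> \<G>" "range (\<lambda>j. slice (2 * j + 1)) \<subseteq> \<G>"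
      using cell by (auto simp: slice_def)
    moreover have "S = \<Union>(range (\<lambda>j. slice (2 * j))) \<union> \<Union>(range (\<lambda>j. slice (2 * j + 1)))"
    proof -
      have "x \<in> \<Union>(range (\<lambda>j. slice (2 * j))) \<union> \<Union>(range (\<lambda>j. slice (2 * j + 1)))" if "x \<in> S" for x
      proof -
        define i where "i = \<phi> x div L"
        have "i = 2 * (i div 2) \<or> i = 2 * (i div 2) + 1" by presburger
        moreover have "x \<in> slice i" using that by (simp add: slice_def i_def)
        ultimately show ?thesis by (metis UnCI UN_I UNIV_I)
      qed
      moreover have "slice j \<subseteq> S" for j by (auto simp: slice_def)
      ultimately show ?thesis by (intro equalityI subsetI) auto
    qed
    moreover have "pairwise (separated r) (range (\<lambda>j. slice (2 * j)))"
    proof (rule pairwiseI, clarsimp)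
      fix i j assume "slice (2 * i) \<noteq> slice (2 * j)"
      then have "i \<noteq> j" by auto
      then show "separated r (slice (2 * i)) (slice (2 * j))" by (intro sep) linarith
    qed
    moreover have "pairwise (separated r) (range (\<lambda>j. slice (2 * j + 1)))"
    proof (rule pairwiseI, clarsimp)
      fix i j assume "slice (2 * i + 1) \<noteq> slice (2 * j + 1)"
      then have "i \<noteq> j" by auto
      then show "separated r (slice (2 * i + 1)) (slice (2 * j + 1))" by (intro sep) linarith
    qed
    ultimately show ?thesis unfolding decomposes_def by (intro exI conjI)
  qed
  then show "\<exists>\<G>. finite_decomposition_complexity \<G> \<and> (\<forall>S\<in>\<F>. decomposes r \<G> S)"
    using G by (intro exI[of _ \<G>] conjI ballI)
qed

section \<open>Word metrics\<close>

lemma proper_metric_space_finite_mcball: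
  assumes "Metric_space M d" and "\<And>x r. x \<in> M \<Longrightarrow> finite (Metric_space.mcball M d x r)"
  shows "proper_metric_space M d"
proof -
  interpret Metric_space M d by fact
  show ?thesis
    using assms(2) mcball_subset_mspace by unfold_locales (auto intro!: finite_imp_compactin)
qed

locale group_with_generators = group G for G (structure) +
  fixes S :: "'a set"
  assumes gens: "S \<subseteq> carrier G"
    and gens_inv: "s \<in> S \<Longrightarrow> inv s \<in> S"
    and generated: "x \<in> carrier G \<Longrightarrow> \<exists>w. set w \<subseteq> S \<and> foldr (\<otimes>) w \<one> = x"
begin

abbreviation eval_word :: "'a list \<Rightarrow> 'a"
  where "eval_word w \<equiv> foldr (\<otimes>) w \<one>"

abbreviation len :: "'a \<Rightarrow> nat"
  where "len \<equiv> word_norm G S"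

lemma eval_word_closed: "set w \<subseteq> S \<Longrightarrow> eval_word w \<in> carrier G"
  using gens by (induction w) auto

lemma eval_word_append:
  "set u \<subseteq> S \<Longrightarrow> set w \<subseteq> S \<Longrightarrow> eval_word (u @ w) = eval_word u \<otimes> eval_word w"
proof (induction u)
  case (Cons a u)
  then show ?case
    using gens eval_word_closed[of u] eval_word_closed[of w] by (auto simp: m_assoc subset_iff)
qed (simp add: eval_word_closed)

lemma eval_word_inverse:
  "set w \<subseteq> S \<Longrightarrow> eval_word (rev (map (\<lambda>s. inv s) w)) = inv (eval_word w)"
proof (induction w)
  case (Cons a w)
  have "set (rev (map (\<lambda>s. inv s) w)) \<subseteq> S" "set [inv a] \<subseteq> S" using Cons.prems gens_inv by auto
  then have "eval_word (rev (map (\<lambda>s. inv s) w) @ [inv a]) = inv (eval_word w) \<otimes> inv a"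
    using Cons gens gens_inv by (subst eval_word_append) (auto simp: subset_iff)
  then show ?case using Cons.prems gens eval_word_closed[of w] by (simp add: inv_mult_group subset_iff)
qed simp

lemma len_le: "set w \<subseteq> S \<Longrightarrow> len (eval_word w) \<le> length w"
  unfolding word_norm_def by (rule Least_le) auto

lemma shortest_word:
  assumes "x \<in> carrier G"
  obtains w where "set w \<subseteq> S" "length w = len x" "eval_word w = x"
proof -
  have "\<exists>n w. set w \<subseteq> S \<and> length w = n \<and> eval_word w = x"
    using generated[OF assms] by blast
  from LeastI_ex[OF this] show ?thesis using that unfolding word_norm_def by blast
qed

lemma len_one: "len \<one> = 0"
  using len_le[of "[]"] by simp

lemma len_eq_0: "x \<in> carrier G \<Longrightarrow> len x = 0 \<Longrightarrow> x = \<one>"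
  by (erule shortest_word) auto

lemma len_inverse_le: "x \<in> carrier G \<Longrightarrow> len (inv x) \<le> len x"
proof (erule shortest_word)
  fix w assume w: "set w \<subseteq> S" "length w = len x" "eval_word w = x"
  have "set (rev (map (\<lambda>s. inv s) w)) \<subseteq> S" using w(1) gens_inv by auto
  from len_le[OF this] show "len (inv x) \<le> len x" using eval_word_inverse[OF w(1)] w by simp
qed

lemma len_mult_le:
  assumes "x \<in> carrier G" "y \<in> carrier G"
  shows "len (x \<otimes> y) \<le> len x + len y"
proof -
  obtain u where u: "set u \<subseteq> S" "length u = len x" "eval_word u = x" using shortest_word assms by blast
  obtain w where w: "set w \<subseteq> S" "length w = len y" "eval_word w = y" using shortest_word assms by blast
  have "set (u @ w) \<subseteq> S" using u w by auto
  from len_le[OF this] show ?thesis using eval_word_append[OF u(1) w(1)] u w by simp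
qed

sublocale word: Metric_space "carrier G" "word_metric G S"
proof
  fix x y z
  show "0 \<le> word_metric G S x y" by (simp add: word_metric_def)
  have le: "len (inv x \<otimes> y) \<le> len (inv y \<otimes> x)" if "x \<in> carrier G" "y \<in> carrier G" for x y
    using len_inverse_le[of "inv y \<otimes> x"] that by (simp add: inv_mult_group)
  show "word_metric G S x y = word_metric G S y x"
    using le[of x y] le[of y x] by (auto simp: word_metric_def)
  assume x: "x \<in> carrier G" and y: "y \<in> carrier G"
  show "word_metric G S x y = 0 \<longleftrightarrow> x = y"
  proof
    assume "word_metric G S x y = 0"
    then have "inv x \<otimes> y = \<one>" using x y len_eq_0[of "inv x \<otimes> y"] by (simp add: word_metric_def)
    then show "x = y" using x y by (metis inv_equality inv_inv inv_closed)
  qed (use x y in \<open>simp add: word_metric_def len_one\<close>)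
  assume z: "z \<in> carrier G"
  have "inv x \<otimes> z = (inv x \<otimes> y) \<otimes> (inv y \<otimes> z)"
    using x y z by (simp add: m_assoc[symmetric]) (simp add: m_assoc)
  then show "word_metric G S x z \<le> word_metric G S x y + word_metric G S y z"
    using len_mult_le[of "inv x \<otimes> y" "inv y \<otimes> z"] x y z by (simp add: word_metric_def)
qed

lemma finite_len_le:
  assumes "finite S"
  shows "finite {x \<in> carrier G. len x \<le> n}"
proof (rule finite_subset)
  show "{x \<in> carrier G. len x \<le> n} \<subseteq> eval_word ` {w. set w \<subseteq> S \<and> length w \<le> n}"
    by (auto elim!: shortest_word)
  show "finite (eval_word ` {w. set w \<subseteq> S \<and> length w \<le> n})"
    using finite_lists_length_le[OF assms] by blast
qed

lemma proper_word_metric: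
  assumes "finite S"
  shows "proper_metric_space (carrier G) (word_metric G S)"
proof (rule proper_metric_space_finite_mcball)
  fix x r assume x: "x \<in> carrier G"
  have "word.mcball x r \<subseteq> (\<lambda>z. x \<otimes> z) ` {z \<in> carrier G. len z \<le> nat \<lfloor>r\<rfloor>}"
  proof
    fix y assume y: "y \<in> word.mcball x r"
    then have "len (inv x \<otimes> y) \<le> nat \<lfloor>r\<rfloor>"
      using x by (simp add: word_metric_def le_nat_floor split: if_splits)
    moreover have "y = x \<otimes> (inv x \<otimes> y)" using x y by (simp add: m_assoc[symmetric])
    ultimately show "y \<in> (\<lambda>z. x \<otimes> z) ` {z \<in> carrier G. len z \<le> nat \<lfloor>r\<rfloor>}"
      using x y by (intro image_eqI) auto
  qed
  then show "finite (word.mcball x r)"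
    using finite_len_le[OF assms] by (rule finite_subset[OF _ finite_imageI])
qed (rule word.Metric_space_axioms)

end

section \<open>The group and its wreath metric\<close>

lemma carrier_ZwrZ: "carrier ZwrZ = {f. finite {i. f i \<noteq> 0}} \<times> UNIV"
  by (auto simp: ZwrZ_def semidirect_product_def carrier_sum_group)

lemma one_ZwrZ: "\<one>\<^bsub>ZwrZ\<^esub> = (\<lambda>_. 0, 0)"
  by (simp add: ZwrZ_def semidirect_product_def restrict_def)

lemma mult_ZwrZ: "x \<otimes>\<^bsub>ZwrZ\<^esub> y = (\<lambda>i. fst x i + fst y (i - snd x), snd x + snd y)"
  by (simp add: ZwrZ_def semidirect_product_def split_beta restrict_def)

lemma finite_support_shift:
  fixes f :: "int \<Rightarrow> int"
  assumes "finite {i. f i \<noteq> 0}"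
  shows "finite {i. f (i - t) \<noteq> 0}"
  using finite_vimageI[OF assms, of "\<lambda>i. i - t"] by (simp add: vimage_def inj_def)

lemma group_ZwrZ: "group ZwrZ"
proof (rule groupI)
  fix x y assume xy: "x \<in> carrier ZwrZ" "y \<in> carrier ZwrZ"
  have "{i. fst x i + fst y (i - snd x) \<noteq> 0} \<subseteq> {i. fst x i \<noteq> 0} \<union> {i. fst y (i - snd x) \<noteq> 0}"
    by auto
  moreover have "finite ({i. fst x i \<noteq> 0} \<union> {i. fst y (i - snd x) \<noteq> 0})"
    using xy finite_support_shift[of "fst y" "snd x"] by (auto simp: carrier_ZwrZ)
  ultimately have "finite {i. fst x i + fst y (i - snd x) \<noteq> 0}" by (rule finite_subset)
  then show "x \<otimes>\<^bsub>ZwrZ\<^esub> y \<in> carrier ZwrZ" by (simp add: carrier_ZwrZ mult_ZwrZ)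
next
  fix x assume x: "x \<in> carrier ZwrZ"
  have "(\<lambda>i. - fst x (i + snd x), - snd x) \<in> carrier ZwrZ"
    using x finite_support_shift[of "fst x" "- snd x"] by (auto simp: carrier_ZwrZ)
  then show "\<exists>y\<in>carrier ZwrZ. y \<otimes>\<^bsub>ZwrZ\<^esub> x = \<one>\<^bsub>ZwrZ\<^esub>"
    by (rule rev_bexI) (simp add: mult_ZwrZ one_ZwrZ)
qed (auto simp: mult_ZwrZ one_ZwrZ carrier_ZwrZ add.assoc diff_diff_eq)

text \<open>Multiplication on the right by a generator moves the cursor by one or changes the lamp under the
  cursor by one. The set \<open>H\<close> of values of words is thus closed under moving the cursor anywhere and
  giving the lamp there any value, and any finite configuration arises from the trivial one in
  this way.\<close>

lemma ZwrZ_generated: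
  assumes "x \<in> carrier ZwrZ"
  shows "\<exists>w. set w \<subseteq> ZwrZ_gens \<and> foldr (\<otimes>\<^bsub>ZwrZ\<^esub>) w \<one>\<^bsub>ZwrZ\<^esub> = x"
proof -
  interpret group ZwrZ by (rule group_ZwrZ)
  define H where "H = {x. \<exists>w. set w \<subseteq> ZwrZ_gens \<and> foldr (\<otimes>\<^bsub>ZwrZ\<^esub>) w \<one>\<^bsub>ZwrZ\<^esub> = x}"
  have gens: "ZwrZ_gens \<subseteq> carrier ZwrZ" by (auto simp: ZwrZ_gens_def carrier_ZwrZ)
  have step: "x \<otimes>\<^bsub>ZwrZ\<^esub> s \<in> H" if x: "x \<in> H" and s: "s \<in> ZwrZ_gens" for x s
  proof -
    obtain w where w: "set w \<subseteq> ZwrZ_gens" "foldr (\<otimes>\<^bsub>ZwrZ\<^esub>) w \<one>\<^bsub>ZwrZ\<^esub> = x"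
      using x by (auto simp: H_def)
    have "foldr (\<otimes>\<^bsub>ZwrZ\<^esub>) w s = foldr (\<otimes>\<^bsub>ZwrZ\<^esub>) w \<one>\<^bsub>ZwrZ\<^esub> \<otimes>\<^bsub>ZwrZ\<^esub> s" using w(1)
    proof (induction w)
      case (Cons a w)
      have "foldr (\<otimes>\<^bsub>ZwrZ\<^esub>) w \<one>\<^bsub>ZwrZ\<^esub> \<in> carrier ZwrZ"
        using Cons.prems gens by (induction w) auto
      moreover have "a \<in> carrier ZwrZ" "s \<in> carrier ZwrZ" using Cons.prems s gens by auto
      ultimately show ?case using Cons by (simp add: m_assoc)
    qed (use s gens in auto)
    then have "foldr (\<otimes>\<^bsub>ZwrZ\<^esub>) (w @ [s]) \<one>\<^bsub>ZwrZ\<^esub> = x \<otimes>\<^bsub>ZwrZ\<^esub> s"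
      using w s gens by auto
    then show ?thesis using w s unfolding H_def by (intro CollectI exI[of _ "w @ [s]"]) auto
  qed
  have move: "(n, t') \<in> H" if "(n, t) \<in> H" for n t t'
  proof (induction t' rule: int_induct[where k = t])
    case base
    then show ?case using that .
  next
    case (step1 i)
    then show ?case using step[of "(n, i)" "(\<lambda>_. 0, 1)"] by (simp add: ZwrZ_gens_def mult_ZwrZ)
  next
    case (step2 i)
    then show ?case using step[of "(n, i)" "(\<lambda>_. 0, -1)"] by (simp add: ZwrZ_gens_def mult_ZwrZ)
  qed
  have switch: "(n(t := m), t) \<in> H" if "(n, t) \<in> H" for n t m
  proof (induction m rule: int_induct[where k = "n t"])
    case base
    then show ?case using that by simp
  next
    case (step1 i)
    have "(n(t := i), t) \<otimes>\<^bsub>ZwrZ\<^esub> (\<lambda>h. if h = 0 then 1 else 0, 0) = (n(t := i + 1), t)"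
      by (auto simp: mult_ZwrZ fun_eq_iff)
    then show ?case using step[OF step1(2)] by (metis ZwrZ_gens_def insertI1)
  next
    case (step2 i)
    have "(n(t := i), t) \<otimes>\<^bsub>ZwrZ\<^esub> (\<lambda>h. if h = 0 then -1 else 0, 0) = (n(t := i - 1), t)"
      by (auto simp: mult_ZwrZ fun_eq_iff)
    then show ?case using step[OF step2(2)] by (metis ZwrZ_gens_def insertI1 insertI2)
  qed
  have "(n, 0) \<in> H" if "finite A" "{i. n i \<noteq> 0} \<subseteq> A" for A n
    using that
  proof (induction A arbitrary: n)
    case empty
    then have "n = (\<lambda>_. 0)" by auto
    then show ?case unfolding H_def by (intro CollectI exI[of _ "[]"]) (auto simp: one_ZwrZ)
  next
    case (insert i A)
    have "(n(i := 0), 0) \<in> H" using insert.prems by (intro insert.IH) auto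
    then have "((n(i := 0))(i := n i), 0) \<in> H" using move switch by blast
    then show ?case by simp
  qed
  then have "(fst x, 0) \<in> H" using assms by (auto simp: carrier_ZwrZ)
  then have "(fst x, snd x) \<in> H" by (rule move)
  then show ?thesis by (auto simp: H_def)
qed

interpretation ZwrZ: group_with_generators ZwrZ ZwrZ_gens
proof (intro group_with_generators.intro group_ZwrZ group_with_generators_axioms.intro ZwrZ_generated)
  show gens: "ZwrZ_gens \<subseteq> carrier ZwrZ" by (auto simp: ZwrZ_gens_def carrier_ZwrZ)
  fix s assume s: "s \<in> ZwrZ_gens"
  interpret group ZwrZ by (rule group_ZwrZ)
  define t where "t = (- fst s, - snd s)"
  have t: "t \<otimes>\<^bsub>ZwrZ\<^esub> s = \<one>\<^bsub>ZwrZ\<^esub>" "t \<in> ZwrZ_gens"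
    using s by (auto simp: t_def ZwrZ_gens_def mult_ZwrZ one_ZwrZ fun_eq_iff)
  have "inv\<^bsub>ZwrZ\<^esub> s = t"
    using t(1) subsetD[OF gens s] subsetD[OF gens t(2)] by (rule inv_equality)
  then show "inv\<^bsub>ZwrZ\<^esub> s \<in> ZwrZ_gens" using t(2) by simp
qed

interpretation wreath: proper_metric_space "carrier ZwrZ" wreath_metric
  unfolding wreath_metric_def by (rule ZwrZ.proper_word_metric) (simp add: ZwrZ_gens_def)

lemma word_norm_ZwrZ_bounds:
  assumes "z \<in> carrier ZwrZ"
  shows "\<bar>snd z\<bar> \<le> int (word_norm ZwrZ ZwrZ_gens z)"
    and "\<bar>fst z i\<bar> \<le> int (word_norm ZwrZ ZwrZ_gens z)"
    and "int (word_norm ZwrZ ZwrZ_gens z) < \<bar>i\<bar> \<Longrightarrow> fst z i = 0"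
proof -
  have *: "\<bar>snd z\<bar> \<le> int (length w) \<and> (\<forall>i. \<bar>fst z i\<bar> \<le> int (length w)) \<and>
      (\<forall>i. int (length w) < \<bar>i\<bar> \<longrightarrow> fst z i = 0)"
    if "set w \<subseteq> ZwrZ_gens" "z = ZwrZ.eval_word w" for w z
    using that
  proof (induction w arbitrary: z)
    case Nil
    then show ?case by (simp add: one_ZwrZ)
  next
    case (Cons s w)
    define y where "y = ZwrZ.eval_word w"
    have y: "\<bar>snd y\<bar> \<le> int (length w)" "\<And>i. \<bar>fst y i\<bar> \<le> int (length w)"
      "\<And>i. int (length w) < \<bar>i\<bar> \<Longrightarrow> fst y i = 0"
      using Cons.IH[OF _ y_def] Cons.prems by auto
    have s: "\<bar>snd s\<bar> \<le> 1" "\<bar>fst s i\<bar> \<le> 1" "i \<noteq> 0 \<Longrightarrow> fst s i = 0" for i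
      using Cons.prems by (auto simp: ZwrZ_gens_def)
    have z: "z = (\<lambda>i. fst s i + fst y (i - snd s), snd s + snd y)"
      using Cons.prems(2) mult_ZwrZ[of s y] by (simp add: y_def)
    have "\<bar>fst z i\<bar> \<le> int (length (s # w))" for i
      using s(2)[of i] y(2)[of "i - snd s"] by (simp add: z)
    moreover have "fst z i = 0" if "int (length (s # w)) < \<bar>i\<bar>" for i
      using s(1) s(3)[of i] y(3)[of "i - snd s"] that by (simp add: z)
    ultimately show ?case using s(1) y(1) by (simp add: z)
  qed
  obtain w where "set w \<subseteq> ZwrZ_gens" "length w = word_norm ZwrZ ZwrZ_gens z" "z = ZwrZ.eval_word w"
    using ZwrZ.shortest_word[OF assms] by metis
  with *[OF this(1,3)] show "\<bar>snd z\<bar> \<le> int (word_norm ZwrZ ZwrZ_gens z)"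
    "\<bar>fst z i\<bar> \<le> int (word_norm ZwrZ ZwrZ_gens z)"
    "int (word_norm ZwrZ ZwrZ_gens z) < \<bar>i\<bar> \<Longrightarrow> fst z i = 0" by auto
qed

lemma ZwrZ_quotient:
  assumes "x \<in> carrier ZwrZ" "y \<in> carrier ZwrZ"
  defines "z \<equiv> inv\<^bsub>ZwrZ\<^esub> x \<otimes>\<^bsub>ZwrZ\<^esub> y"
  shows "z \<in> carrier ZwrZ" "wreath_metric x y = real (word_norm ZwrZ ZwrZ_gens z)"
    "snd z = snd y - snd x" "fst z i = fst y (i + snd x) - fst x (i + snd x)"
proof -
  show z: "z \<in> carrier ZwrZ" using assms by auto
  show "wreath_metric x y = real (word_norm ZwrZ ZwrZ_gens z)"
    using assms by (simp add: wreath_metric_def word_metric_def)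
  have "x \<otimes>\<^bsub>ZwrZ\<^esub> z = y"
    using assms by (simp add: z_def ZwrZ.m_assoc[symmetric])
  then have "y = (\<lambda>i. fst x i + fst z (i - snd x), snd x + snd z)" by (simp add: mult_ZwrZ)
  then show "snd z = snd y - snd x" "fst z i = fst y (i + snd x) - fst x (i + snd x)" by auto
qed

text \<open>The three ways in which the distance controls a displacement. The first two provide the Lipschitz
  functions used for slicing; the third separates configurations that differ far from the cursor.\<close>

lemma wreath_metric_bounds:
  assumes "x \<in> carrier ZwrZ" "y \<in> carrier ZwrZ"
  shows "real_of_int \<bar>snd x - snd y\<bar> \<le> wreath_metric x y"
    and "real_of_int \<bar>fst x i - fst y i\<bar> \<le> wreath_metric x y"
    and "wreath_metric x y < real_of_int \<bar>i - snd x\<bar> \<Longrightarrow> fst x i = fst y i"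
proof -
  define z where "z = inv\<^bsub>ZwrZ\<^esub> x \<otimes>\<^bsub>ZwrZ\<^esub> y"
  note q = ZwrZ_quotient[OF assms, folded z_def]
  show "real_of_int \<bar>snd x - snd y\<bar> \<le> wreath_metric x y"
    using word_norm_ZwrZ_bounds(1)[OF q(1)] unfolding q(2,3) by linarith
  show "real_of_int \<bar>fst x i - fst y i\<bar> \<le> wreath_metric x y"
    using word_norm_ZwrZ_bounds(2)[OF q(1), of "i - snd x"] q(4)[of "i - snd x"] unfolding q(2) by auto
  assume "wreath_metric x y < real_of_int \<bar>i - snd x\<bar>"
  then show "fst x i = fst y i"
    using word_norm_ZwrZ_bounds(3)[OF q(1), of "i - snd x"] q(4)[of "i - snd x"] unfolding q(2) by auto
qed

section \<open>Finite decomposition complexity of the wreath product\<close>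

text \<open>Sets in which the cursor stays in a window \<open>[a, a + W)\<close>, the lamps outside the window are constant,
  and all lamps of the window except the \<open>k\<close> leftmost ones vary by at most \<open>B\<close>. The position \<open>a\<close>
  is arbitrary, so the translates of a box belong to the same family. The last condition extends to
  the lamps on the right of the window, which are constant, so \<open>B\<close> is meant to be non-negative.\<close>

definition lamp_boxes :: "int \<Rightarrow> int \<Rightarrow> nat \<Rightarrow> ((int \<Rightarrow> int) \<times> int) set set"
  where "lamp_boxes W B k = {S. S \<subseteq> carrier ZwrZ \<and> (\<exists>a. \<forall>x\<in>S. \<forall>y\<in>S. a \<le> snd x \<and> snd x < a + W \<and>
    (\<forall>i. (i < a \<or> a + W \<le> i) \<longrightarrow> fst x i = fst y i) \<and>
    (\<forall>i. a + int k \<le> i \<longrightarrow> \<bar>fst x i - fst y i\<bar> \<le> B))}"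

text \<open>The quotient \<open>inv x \<otimes> y\<close> of two points of a box has bounded lamps, cursor and support, whatever the
  position of the box. This leaves finitely many quotients, hence finitely many distances.\<close>

lemma lamp_boxes_0: "wreath.finite_decomposition_complexity (lamp_boxes W B 0)"
proof -
  define N where "N = word_norm ZwrZ ZwrZ_gens"
  (* The value 0 of the lamps outside the window must be allowed even if B is negative. *)
  define Z :: "((int \<Rightarrow> int) \<times> int) set" where
    "Z = {f. \<forall>i. (i \<in> {-W..W} \<longrightarrow> f i \<in> {-\<bar>B\<bar>..\<bar>B\<bar>}) \<and> (i \<notin> {-W..W} \<longrightarrow> f i = 0)} \<times> {-W..W}"
  have "finite Z"
    unfolding Z_def by (intro finite_cartesian_product finite_set_of_finite_funs) auto
  then have N: "N z \<le> Max (N ` Z)" if "z \<in> Z" for z using that by auto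
  show ?thesis
  proof (rule wreath.finite_decomposition_complexity.bounded)
    fix S x y assume S: "S \<in> lamp_boxes W B 0" and xy: "x \<in> S" "y \<in> S"
    then obtain a where M: "S \<subseteq> carrier ZwrZ" and a: "\<forall>x\<in>S. \<forall>y\<in>S. a \<le> snd x \<and> snd x < a + W \<and>
      (\<forall>i. (i < a \<or> a + W \<le> i) \<longrightarrow> fst x i = fst y i) \<and>
      (\<forall>i. a \<le> i \<longrightarrow> \<bar>fst x i - fst y i\<bar> \<le> B)"
      by (auto simp: lamp_boxes_def)
    have axy: "a \<le> snd x" "snd x < a + W" "a \<le> snd y" "snd y < a + W"
      "\<And>i. i < a \<or> a + W \<le> i \<Longrightarrow> fst x i = fst y i" "\<And>i. a \<le> i \<Longrightarrow> \<bar>fst x i - fst y i\<bar> \<le> B"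
      using a xy by auto
    have xyM: "x \<in> carrier ZwrZ" "y \<in> carrier ZwrZ" using xy M by auto
    define z where "z = inv\<^bsub>ZwrZ\<^esub> x \<otimes>\<^bsub>ZwrZ\<^esub> y"
    note q = ZwrZ_quotient[OF xyM, folded z_def]
    have "fst z i \<in> {-\<bar>B\<bar>..\<bar>B\<bar>}" for i
      using axy(5)[of "i + snd x"] axy(6)[of "i + snd x"] by (cases "i + snd x < a") (auto simp: q(4))
    moreover have "fst z i = 0" if "i \<notin> {-W..W}" for i
      using axy(1,2) axy(5)[of "i + snd x"] that by (auto simp: q(4))
    moreover have "snd z \<in> {-W..W}" using axy(1-4) by (auto simp: q(3))
    ultimately have "z \<in> Z" by (auto simp: Z_def mem_Times_iff)
    from N[OF this] show "x \<in> carrier ZwrZ \<and> wreath_metric x y \<le> real (Max (N ` Z))"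
      using xyM by (simp add: q(2) N_def)
  qed
qed

text \<open>Slicing by the rightmost of the \<open>k + 1\<close> unrestricted lamps, with slices of width \<open>L\<close>, confines that
  lamp to a range of length \<open>L\<close> and leaves \<open>k\<close> unrestricted ones.\<close>

lemma lamp_boxes: "wreath.finite_decomposition_complexity (lamp_boxes W B k)"
proof (induction k arbitrary: B)
  case 0
  show ?case by (rule lamp_boxes_0)
next
  case (Suc k)
  show ?case
  proof (rule wreath.finite_decomposition_complexity_slices)
    fix L :: int assume L: "0 < L"
    have "\<exists>\<phi> :: _ \<Rightarrow> int. (\<forall>x\<in>S. \<forall>y\<in>S. real_of_int \<bar>\<phi> x - \<phi> y\<bar> \<le> wreath_metric x y) \<and>
        (\<forall>j. {x \<in> S. \<phi> x div L = j} \<in> lamp_boxes W (max B L) k)"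
      if S: "S \<in> lamp_boxes W B (Suc k)" for S
    proof -
      obtain a where M: "S \<subseteq> carrier ZwrZ" and a: "\<forall>x\<in>S. \<forall>y\<in>S. a \<le> snd x \<and> snd x < a + W \<and>
        (\<forall>i. (i < a \<or> a + W \<le> i) \<longrightarrow> fst x i = fst y i) \<and>
        (\<forall>i. a + int (Suc k) \<le> i \<longrightarrow> \<bar>fst x i - fst y i\<bar> \<le> B)"
        using S unfolding lamp_boxes_def by blast
      have "{x \<in> S. fst x (a + int k) div L = j} \<in> lamp_boxes W (max B L) k" for j
      proof -
        have "\<bar>fst x i - fst y i\<bar> \<le> max B L"
          if xy: "x \<in> S" "y \<in> S" "fst x (a + int k) div L = j" "fst y (a + int k) div L = j"
            and i: "a + int k \<le> i" for x y i
        proof (cases "i = a + int k")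
          case True
          have "\<bar>u - v\<bar> \<le> L" if "u div L = v div L" for u v :: int
            using that int_div_bounds[OF L, of u] int_div_bounds[OF L, of v] by (simp add: abs_le_iff)
          then show ?thesis using True xy by (simp add: le_max_iff_disj)
        next
          case False
          then have "\<bar>fst x i - fst y i\<bar> \<le> B" using a xy(1,2) i by auto
          then show ?thesis by simp
        qed
        then show ?thesis
          unfolding lamp_boxes_def using M a by (intro CollectI conjI exI[of _ a]) auto
      qed
      then show ?thesis
        using wreath_metric_bounds(2)[OF subsetD[OF M] subsetD[OF M]]
        by (intro exI[of _ "\<lambda>x. fst x (a + int k)"] conjI ballI allI)
    qed
    then show "\<exists>\<G>. wreath.finite_decomposition_complexity \<G> \<and>
      (\<forall>S\<in>lamp_boxes W B (Suc k). \<exists>\<phi> :: _ \<Rightarrow> int.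
        (\<forall>x\<in>S. \<forall>y\<in>S. real_of_int \<bar>\<phi> x - \<phi> y\<bar> \<le> wreath_metric x y) \<and> (\<forall>j. {x \<in> S. \<phi> x div L = j} \<in> \<G>))"
      using Suc.IH by blast
  qed
qed

definition cursor_strips :: "int \<Rightarrow> ((int \<Rightarrow> int) \<times> int) set set"
  where "cursor_strips L = {S. S \<subseteq> carrier ZwrZ \<and> (\<exists>a. \<forall>x\<in>S. a \<le> snd x \<and> snd x < a + L)}"

text \<open>A path of length at most \<open>r\<close> that starts in the strip over \<open>[a, a + L)\<close> changes no lamp outside
  \<open>[a - r, a + L + r)\<close>. Points of the strip whose lamps differ there are therefore more than \<open>r\<close>
  apart, and the classes of points that agree there form a decomposition into boxes with one colour
  only. The width of the boxes depends on \<open>r\<close> and \<open>L\<close> but not on \<open>a\<close>.\<close>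

lemma cursor_strips: "wreath.finite_decomposition_complexity (cursor_strips L)"
proof (rule wreath.finite_decomposition_complexity.decompose)
  fix r :: real
  define m where "m = max 0 \<lceil>r\<rceil>"
  have m: "0 \<le> m" "r \<le> real_of_int m"
    using le_of_int_ceiling[of r] by (auto simp: m_def max_def)
  (* A lamp of index a + L + m has distance more than m from the cursor, which is at most
     a + L - 1, so the window [a - m, a + L + m + 1) covers everything within reach. *)
  define W where "W = L + 2 * m + 1"
  have "wreath.decomposes r (lamp_boxes W 0 (nat W)) S" if S: "S \<in> cursor_strips L" for S
  proof -
    obtain a where M: "S \<subseteq> carrier ZwrZ" and a: "\<And>x. x \<in> S \<Longrightarrow> a \<le> snd x \<and> snd x < a + L"
      using S by (auto simp: cursor_strips_def)
    define coset where "coset x = {y \<in> S. \<forall>i. i < a - m \<or> a - m + W \<le> i \<longrightarrow> fst y i = fst x i}"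
      for x :: "(int \<Rightarrow> int) \<times> int"
    have "coset x \<in> lamp_boxes W 0 (nat W)" for x
    proof -
      have "\<forall>y\<in>coset x. \<forall>z\<in>coset x. a - m \<le> snd y \<and> snd y < a - m + W \<and>
        (\<forall>i. (i < a - m \<or> a - m + W \<le> i) \<longrightarrow> fst y i = fst z i) \<and>
        (\<forall>i. a - m + int (nat W) \<le> i \<longrightarrow> \<bar>fst y i - fst z i\<bar> \<le> 0)"
      proof (intro ballI)
        fix y z assume yz: "y \<in> coset x" "z \<in> coset x"
        have "fst y i = fst z i" if "i < a - m \<or> a - m + W \<le> i" for i
          using yz that by (auto simp: coset_def)
        moreover have "a \<le> snd y \<and> snd y < a + L" using yz a by (auto simp: coset_def)
        ultimately show "a - m \<le> snd y \<and> snd y < a - m + W \<and>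
          (\<forall>i. (i < a - m \<or> a - m + W \<le> i) \<longrightarrow> fst y i = fst z i) \<and>
          (\<forall>i. a - m + int (nat W) \<le> i \<longrightarrow> \<bar>fst y i - fst z i\<bar> \<le> 0)"
          using m(1) by (auto simp: W_def)
      qed
      moreover have "coset x \<subseteq> carrier ZwrZ" using M by (auto simp: coset_def)
      ultimately show ?thesis unfolding lamp_boxes_def by blast
    qed
    then have "coset ` S \<subseteq> lamp_boxes W 0 (nat W)" by blast
    moreover have "S = \<Union>(coset ` S) \<union> \<Union>{}" by (auto simp: coset_def)
    moreover have "pairwise (wreath.separated r) (coset ` S)"
    proof (rule pairwiseI)
      fix P Q assume "P \<in> coset ` S" "Q \<in> coset ` S" and ne: "P \<noteq> Q"
      then obtain p q where pq: "P = coset p" "Q = coset q" by blast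
      show "wreath.separated r P Q"
        unfolding wreath.separated_def
      proof (intro ballI)
        fix x y assume xy: "x \<in> P" "y \<in> Q"
        show "r < wreath_metric x y"
        proof (rule ccontr)
          assume "\<not> r < wreath_metric x y"
          then have r: "wreath_metric x y \<le> real_of_int m" using m(2) by linarith
          have xS: "x \<in> S" "y \<in> S" using xy pq by (auto simp: coset_def)
          have "fst x i = fst y i" if "i < a - m \<or> a - m + W \<le> i" for i
          proof (rule wreath_metric_bounds(3))
            have "m < \<bar>i - snd x\<bar>" using that a[OF xS(1)] m(1) by (auto simp: W_def)
            then show "wreath_metric x y < real_of_int \<bar>i - snd x\<bar>" using r by linarith
          qed (use xS M in auto)
          then have "P = Q" using xy unfolding pq coset_def by auto
          then show False using ne by simp
        qed
      qed
    qed
    ultimately show ?thesis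
      unfolding wreath.decomposes_def
      by (intro exI[of _ "coset ` S"] exI[of _ "{}"] conjI) (auto simp: pairwise_def)
  qed
  then show "\<exists>\<G>. wreath.finite_decomposition_complexity \<G> \<and> (\<forall>S\<in>cursor_strips L. wreath.decomposes r \<G> S)"
    using lamp_boxes by blast
qed

lemma ZwrZ_finite_decomposition_complexity:
  "wreath.finite_decomposition_complexity {carrier ZwrZ}"
proof (rule wreath.finite_decomposition_complexity_slices)
  fix L :: int assume L: "0 < L"
  have slice: "{x \<in> carrier ZwrZ. snd x div L = j} \<in> cursor_strips L" for j
  proof -
    have "j * L \<le> t \<and> t < j * L + L" if "t div L = j" for t
      using that int_div_bounds[OF L, of t] by auto
    then show ?thesis unfolding cursor_strips_def by (intro CollectI conjI exI[of _ "j * L"]) auto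
  qed
  show "\<exists>\<G>. wreath.finite_decomposition_complexity \<G> \<and>
    (\<forall>S\<in>{carrier ZwrZ}. \<exists>\<phi> :: _ \<Rightarrow> int.
      (\<forall>x\<in>S. \<forall>y\<in>S. real_of_int \<bar>\<phi> x - \<phi> y\<bar> \<le> wreath_metric x y) \<and> (\<forall>j. {x \<in> S. \<phi> x div L = j} \<in> \<G>))"
  proof (intro exI[of _ "cursor_strips L"] conjI ballI)
    fix S assume S: "S \<in> {carrier ZwrZ}"
    show "\<exists>\<phi> :: _ \<Rightarrow> int. (\<forall>x\<in>S. \<forall>y\<in>S. real_of_int \<bar>\<phi> x - \<phi> y\<bar> \<le> wreath_metric x y) \<and>
        (\<forall>j. {x \<in> S. \<phi> x div L = j} \<in> cursor_strips L)"
      using slice wreath_metric_bounds(1) unfolding singletonD[OF S]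
      by (intro exI[of _ snd] conjI ballI allI)
  qed (rule cursor_strips)
qed

theorem corollary3p2:
  fixes R :: "('r, 'k) ring_scheme"
  assumes "cring R"
  shows "proper_metric_space (carrier ZwrZ) wreath_metric \<and>
    proper_metric_space.coarsely_coherent (carrier ZwrZ) wreath_metric R
      TYPE('e1) TYPE('e) TYPE('e2)"
  using wreath.proper_metric_space_axioms
    wreath.finite_decomposition_complexity_imp_coarsely_coherent[OF ZwrZ_finite_decomposition_complexity]
  by (rule conjI)

end
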